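(* Let $n$ be a positive integer, $p,q\in\,]0,\infty]$ and $A>0$. If for some $t\in\mathbb{R}$ and $r\in\,]0,\infty]$ there exists $c\in\,]0,\infty[$ such that every $u\in\mathcal{S}(\mathbb{R}^n)$ satisfies $$\|u\|_{B^t_{r,\infty}(\mathbb{R}^n)}\le c\Big(\sum_{j=0}^\infty 2^{j(\frac np-n)q}\|u_j\|_{L_p}^q\Big)^{1/q}$$ whenever $u=\sum_{j=0}^\infty u_j$ is a decomposition, with $u_j\in\mathcal{S}'(\mathbb{R}^n)$ and convergence in $\mathcal{S}'(\mathbb{R}^n)$, satisfying $$\operatorname{supp}\mathcal{F}u_j\subset\{\xi\in\mathbb{R}^n\mid|\xi|\le A2^j\}\quad\text{for all } j\ge0,$$ then $r\ge q$. Consequently, for $0<p<q\le1$, the receiving space $B^{\frac nq-n}_{q,\infty}(\mathbb{R}^n)$ is optimal with respect to the integral-exponent for the sums of such series: there are no $r\in\,]0,q[$, $t\in\mathbb{R}$ and $c<\infty$ such that, for every series $\sum u_j$ of distributions $u_j\in\mathcal{S}'(\mathbb{R}^n)$ satisfying $\operatorname{supp}\mathcal{F}u_j\subset\{\xi\in\mathbb{R}^n\mid|\xi|\le A2^j\}$ for all $j\ge0$ and $$B:=\Big(\sum_{j=0}^\infty2^{j(\frac np-n)q}\|u_j\|_{L_p}^q\Big)^{1/q}<\infty,$$ the sum $u=\sum u_j$ belongs to $B^t_{r,\infty}(\mathbb{R}^n)$ with $\|u\|_{B^t_{r,\infty}}\le cB$.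
   Context: $\|u_j\|_{L_p}$ is understood as $+\infty$ if $u_j\notin L_p(\mathbb{R}^n)$, and the right-hand sides are read with a supremum over $j$ if $q=\infty$. $\mathcal{F}u=\hat u$ is the Fourier transform. Besov spaces: let $\Psi\colon\mathbb{R}\to\mathbb{R}$ be a $C^\infty$ function with $\Psi(t)=1$ for $t<11/10$ and $\Psi(t)=0$ for $t>13/10$. Put $\Psi_j(\xi)=\Psi(2^{-j}|\xi|)$ for $j\ge0$, $\Phi_0=\Psi_0$ and $\Phi_j=\Psi_j-\Psi_{j-1}$ for $j\ge1$, so that $1=\sum_{j\ge0}\Phi_j$ on $\mathbb{R}^n$. For $s\in\mathbb{R}$ and $p,q\in\,]0,\infty]$, $B^s_{p,q}(\mathbb{R}^n)$ is the set of $u\in\mathcal{S}'(\mathbb{R}^n)$ with $$\|u\|_{B^s_{p,q}}=\Big(\sum_{k=0}^\infty 2^{skq}\|\mathcal{F}^{-1}(\Phi_k\hat u)\|_{L_p}^q\Big)^{1/q}<\infty$$ (supremum over $k$ if $q=\infty$); $p$ is called the integral-exponent. Background for the last assertion: for $0<p<q\le1$, any series $\sum u_j$ satisfying $\operatorname{supp}\mathcal{F}u_j\subset\{\xi\in\mathbb{R}^n\mid|\xi|\le A2^j\}$ for all $j\ge0$, with $B=\big(\sum_{j=0}^\infty2^{j(\frac np-n)q}\|u_j\|_{L_p}^q\big)^{1/q}<\infty$, converges in $L_1(\mathbb{R}^n)$ to a limit $u\in B^{\frac nq-n}_{q,\infty}(\mathbb{R}^n)$ with $\|u\|_{B^{\frac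 nq-n}_{q,\infty}}\le c\,B$, the constant depending only on $n,p,q,A$; this is what "receiving space" refers to. *)

theory Defs
  imports "HOL-Probability.Essential_Supremum"
begin

section \<open>Smooth functions, Schwartz functions, test functions\<close>

text \<open>Iterated partial derivative along a list of directions. Multi-indices are encoded as lists
  of basis vectors.\<close>

fun partials :: "'a::euclidean_space list \<Rightarrow> ('a \<Rightarrow> 'b::real_normed_vector) \<Rightarrow> 'a \<Rightarrow> 'b" where
  "partials [] f = f"
| "partials (b # bs) f = (\<lambda>x. frechet_derivative (partials bs f) (at x) b)"

text \<open>If all iterated partial derivatives are Frechet differentiable, they are in particular
  continuous, so this is the class of \<open>C\<^sup>\<infinity>\<close> functions.\<close>

definition smooth :: "('a::euclidean_space \<Rightarrow> 'b::real_normed_vector) \<Rightarrow> bool" where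
  "smooth f \<longleftrightarrow> (\<forall>bs x. set bs \<subseteq> Basis \<longrightarrow> partials bs f differentiable (at x))"

definition schwartz :: "('a::euclidean_space \<Rightarrow> complex) \<Rightarrow> bool" where
  "schwartz \<phi> \<longleftrightarrow> smooth \<phi> \<and>
     (\<forall>k bs. set bs \<subseteq> Basis \<longrightarrow>
        bdd_above (range (\<lambda>x. (1 + norm x) ^ k * norm (partials bs \<phi> x))))"

definition schwartz_seminorm :: "nat \<Rightarrow> ('a::euclidean_space \<Rightarrow> complex) \<Rightarrow> real" where
  "schwartz_seminorm N \<phi> =
     (\<Sum>bs\<in>{bs. set bs \<subseteq> Basis \<and> length bs \<le> N}.
        SUP x. (1 + norm x) ^ N * norm (partials bs \<phi> x))"

definition test_function :: "('a::euclidean_space \<Rightarrow> complex) \<Rightarrow> bool" where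
  "test_function \<phi> \<longleftrightarrow> smooth \<phi> \<and> compact (closure {x. \<phi> x \<noteq> 0})"


section \<open>Tempered distributions\<close>

text \<open>A tempered distribution is a functional on all functions of which only the values at
  Schwartz functions matter: no notion below uses any other value.\<close>

type_synonym 'a distr = "('a \<Rightarrow> complex) \<Rightarrow> complex"

definition tempered :: "'a::euclidean_space distr \<Rightarrow> bool" where
  "tempered u \<longleftrightarrow>
     (\<forall>\<phi> \<psi>. schwartz \<phi> \<longrightarrow> schwartz \<psi> \<longrightarrow> u (\<lambda>x. \<phi> x + \<psi> x) = u \<phi> + u \<psi>) \<and>
     (\<forall>a \<phi>. schwartz \<phi> \<longrightarrow> u (\<lambda>x. a * \<phi> x) = a * u \<phi>) \<and>
     (\<exists>C N. \<forall>\<phi>. schwartz \<phi> \<longrightarrow> norm (u \<phi>) \<le> C * schwartz_seminorm N \<phi>)"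

definition distr_of :: "('a::euclidean_space \<Rightarrow> complex) \<Rightarrow> 'a distr" where
  "distr_of f \<phi> = (\<integral>x. f x * \<phi> x \<partial>lborel)"

text \<open>\<open>u = \<Sum>j. us j\<close>, in the weak-* sense.\<close>

definition distr_sums :: "(nat \<Rightarrow> 'a::euclidean_space distr) \<Rightarrow> 'a distr \<Rightarrow> bool" where
  "distr_sums us u \<longleftrightarrow> (\<forall>\<phi>. schwartz \<phi> \<longrightarrow> (\<lambda>j. us j \<phi>) sums u \<phi>)"

definition distr_supp :: "'a::euclidean_space distr \<Rightarrow> 'a set" where
  "distr_supp u =
     - \<Union>{U. open U \<and> (\<forall>\<phi>. test_function \<phi> \<and> closure {x. \<phi> x \<noteq> 0} \<subseteq> U \<longrightarrow> u \<phi> = 0)}"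

definition distr_mult :: "('a \<Rightarrow> complex) \<Rightarrow> 'a::euclidean_space distr \<Rightarrow> 'a distr" where
  "distr_mult m u \<phi> = u (\<lambda>x. m x * \<phi> x)"

definition fourier :: "('a::euclidean_space \<Rightarrow> complex) \<Rightarrow> 'a \<Rightarrow> complex" where
  "fourier \<phi> \<xi> = (\<integral>x. exp (- \<i> * of_real (x \<bullet> \<xi>)) * \<phi> x \<partial>lborel)"

definition inv_fourier :: "('a::euclidean_space \<Rightarrow> complex) \<Rightarrow> 'a \<Rightarrow> complex" where
  "inv_fourier \<phi> x =
     of_real ((2 * pi) powr (- real DIM('a))) *
       (\<integral>\<xi>. exp (\<i> * of_real (x \<bullet> \<xi>)) * \<phi> \<xi> \<partial>lborel)"

definition distr_fourier :: "'a::euclidean_space distr \<Rightarrow> 'a distr" where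
  "distr_fourier u \<phi> = u (fourier \<phi>)"

definition distr_inv_fourier :: "'a::euclidean_space distr \<Rightarrow> 'a distr" where
  "distr_inv_fourier u \<phi> = u (inv_fourier \<phi>)"


section \<open>Quasi-norms with exponents in \<open>]0,\<infinity>]\<close>\<close>

text \<open>Only used for \<open>a > 0\<close>, where \<open>0\<^sup>a = 0\<close> and \<open>\<infinity>\<^sup>a = \<infinity>\<close>.\<close>

definition ennreal_rpow :: "ennreal \<Rightarrow> real \<Rightarrow> ennreal" where
  "ennreal_rpow x a = (if x = \<infinity> then \<infinity> else ennreal (enn2real x powr a))"

definition Lp_norm :: "ennreal \<Rightarrow> ('a::euclidean_space \<Rightarrow> complex) \<Rightarrow> ennreal" where
  "Lp_norm p f =
     (if p = \<infinity> then esssup lborel (\<lambda>x. ennreal (norm (f x)))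
      else ennreal_rpow (\<integral>\<^sup>+x. ennreal_rpow (ennreal (norm (f x))) (enn2real p) \<partial>lborel)
             (1 / enn2real p))"

definition lq_norm :: "ennreal \<Rightarrow> (nat \<Rightarrow> ennreal) \<Rightarrow> ennreal" where
  "lq_norm q a =
     (if q = \<infinity> then (SUP j. a j)
      else ennreal_rpow (\<Sum>j. ennreal_rpow (a j) (enn2real q)) (1 / enn2real q))"

text \<open>\<open>u\<close> is the regular distribution given by the locally integrable function \<open>f\<close>. Testing against
  compactly supported functions only, so that \<open>f * \<phi>\<close> need not be absolutely integrable for every
  Schwartz function \<open>\<phi>\<close>.\<close>

definition represented_by :: "'a::euclidean_space distr \<Rightarrow> ('a \<Rightarrow> complex) \<Rightarrow> bool" where
  "represented_by u f \<longleftrightarrow>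
     f \<in> borel_measurable lborel \<and>
     (\<forall>K. compact K \<longrightarrow> set_integrable lborel K f) \<and>
     (\<forall>\<phi>. test_function \<phi> \<longrightarrow> u \<phi> = distr_of f \<phi>)"

text \<open>The representing function is unique almost everywhere, so the infimum is over at most one
  value; it is \<open>\<infinity>\<close> if \<open>u\<close> is not a function, or is a function outside \<open>L\<^sub>p\<close>.\<close>

definition distr_Lp_norm :: "ennreal \<Rightarrow> 'a::euclidean_space distr \<Rightarrow> ennreal" where
  "distr_Lp_norm p u = (INF f\<in>{f. represented_by u f}. Lp_norm p f)"


section \<open>Besov spaces\<close>

definition cutoff :: "(real \<Rightarrow> real) \<Rightarrow> bool" where
  "cutoff \<Psi> \<longleftrightarrow> smooth \<Psi> \<and> (\<forall>t < 11/10. \<Psi> t = 1) \<and> (\<forall>t > 13/10. \<Psi> t = 0)"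

definition LP_Psi :: "(real \<Rightarrow> real) \<Rightarrow> nat \<Rightarrow> 'a::euclidean_space \<Rightarrow> real" where
  "LP_Psi \<Psi> j \<xi> = \<Psi> (norm \<xi> / 2 ^ j)"

definition LP_Phi :: "(real \<Rightarrow> real) \<Rightarrow> nat \<Rightarrow> 'a::euclidean_space \<Rightarrow> real" where
  "LP_Phi \<Psi> j \<xi> =
     (if j = 0 then LP_Psi \<Psi> 0 \<xi> else LP_Psi \<Psi> j \<xi> - LP_Psi \<Psi> (j - 1) \<xi>)"

definition LP_block :: "(real \<Rightarrow> real) \<Rightarrow> nat \<Rightarrow> 'a::euclidean_space distr \<Rightarrow> 'a distr" where
  "LP_block \<Psi> k u =
     distr_inv_fourier (distr_mult (\<lambda>\<xi>. of_real (LP_Phi \<Psi> k \<xi>)) (distr_fourier u))"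

definition besov_norm ::
  "(real \<Rightarrow> real) \<Rightarrow> real \<Rightarrow> ennreal \<Rightarrow> ennreal \<Rightarrow> 'a::euclidean_space distr \<Rightarrow> ennreal" where
  "besov_norm \<Psi> s p q u =
     lq_norm q (\<lambda>k. ennreal (2 powr (s * real k)) * distr_Lp_norm p (LP_block \<Psi> k u))"

definition besov_space ::
  "(real \<Rightarrow> real) \<Rightarrow> real \<Rightarrow> ennreal \<Rightarrow> ennreal \<Rightarrow> 'a::euclidean_space distr set" where
  "besov_space \<Psi> s p q = {u. tempered u \<and> besov_norm \<Psi> s p q u < \<infinity>}"


section \<open>Series with spectra in dyadic balls\<close>

definition dyadic_series :: "real \<Rightarrow> (nat \<Rightarrow> 'a::euclidean_space distr) \<Rightarrow> bool" where
  "dyadic_series A us \<longleftrightarrow>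
     (\<forall>j. tempered (us j) \<and> distr_supp (distr_fourier (us j)) \<subseteq> {\<xi>. norm \<xi> \<le> A * 2 ^ j})"

text \<open>The quantity \<open>(\<Sum>j. 2\<^bsup>j(n/p-n)q\<^esup> \<parallel>us j\<parallel>\<^sub>p\<^sup>q)\<^bsup>1/q\<^esup>\<close>; note \<open>enn2real (1 / \<infinity>) = 0\<close>.\<close>

definition series_bound ::
  "ennreal \<Rightarrow> ennreal \<Rightarrow> (nat \<Rightarrow> 'a::euclidean_space distr) \<Rightarrow> ennreal" where
  "series_bound p q us =
     lq_norm q (\<lambda>j. ennreal (2 powr (real j * (real DIM('a) * enn2real (1 / p) - real DIM('a)))) *
                      distr_Lp_norm p (us j))"

end

theory Submission
  imports Defs "HOL-Probability.Probability"
begin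

text \<open>
  Every series used here is built from one function \<open>G\<close>, the inverse Fourier transform of
  \<open>\<Phi>\<^sub>0(\<xi>) = \<Psi>(\<bar>\<xi>\<bar>)\<close>, by dilation and translation. Put
  \<open>V\<^sub>i(x) = 2\<^sup>i\<^sup>n G(2\<^sup>i (x - y\<^sub>i))\<close> for \<open>i = 1, \<dots>, N\<close>. The Fourier transform of \<open>V\<^sub>i\<close> is
  \<open>exp(-i y\<^sub>i \<bullet> \<xi>) \<Phi>\<^sub>0(2\<^sup>-\<^sup>i \<xi>)\<close>, which lives in a ball of radius \<open>13/10 \<cdot> 2\<^sup>i\<close>; so, if \<open>m\<close> is such that
  \<open>2\<^sup>m A > 13/10\<close>, then \<open>V\<^sub>i\<close> may be the term of index \<open>i + m\<close>. Two quantities are compared.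

  \<^item> The factor \<open>2\<^sup>j\<^sup>(\<^sup>n\<^sup>/\<^sup>p\<^sup>-\<^sup>n\<^sup>)\<close> exactly compensates the dilation, so all \<open>N\<close> nonzero terms contribute the same
    amount, and the right-hand side of the inequality is a constant times \<open>N\<^sup>1\<^sup>/\<^sup>q\<close>.

  \<^item> For \<open>i \<ge> 1\<close> the function \<open>\<Phi>\<^sub>0(2\<^sup>-\<^sup>i \<xi>)\<close> is \<open>1\<close> on the support of \<open>\<Phi>\<^sub>0\<close>. Hence the block of frequency
    index \<open>0\<close> of the sum is \<open>\<Sum>\<^sub>i G(x - y\<^sub>i)\<close>, a sum of translates of a single function. If the \<open>y\<^sub>i\<close>
    are far apart, its \<open>L\<^sub>r\<close> quasi-norm is at least a constant times \<open>N\<^sup>1\<^sup>/\<^sup>r\<close>. This block has weight \<open>1\<close>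
    for every \<open>t\<close>, so it bounds the Besov quasi-norm from below.

  The constants do not depend on \<open>N\<close>, so \<open>N \<rightarrow> \<infinity>\<close> rules out \<open>r < q\<close> (lemmas \<open>extremal_series\<close>,
  \<open>unbounded_ratio\<close>). Both assertions follow from these finite sums, which are Schwartz functions.

  Three general facts carry the computation. The inverse Fourier transform of a test function is
  a Schwartz function (\<open>schwartz_inv_fourier\<close>), which gives all the decay and integrability. Fourier
  inversion holds for test functions (\<open>fourier_inv_fourier\<close>); it gives the spectra of the terms and, in
  particular, \<open>G \<noteq> 0\<close>. Finally, functions that represent the same distribution agree almost
  everywhere (\<open>represented_by_unique\<close>); without it, the infimum over representing functions that
  defines \<open>distr_Lp_norm\<close> could not be bounded from below.
\<close>

section \<open>Closure properties of smooth functions\<close>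

text \<open>Smoothness is the largest class of differentiable functions closed under partial derivatives.
  This replaces the computation of iterated partial derivatives by the choice of a closed class.\<close>
lemma smooth_coinduct:
  assumes "f \<in> S"
    and diff: "\<And>g x. g \<in> S \<Longrightarrow> g differentiable (at x)"
    and closed: "\<And>g b. g \<in> S \<Longrightarrow> b \<in> Basis \<Longrightarrow> (\<lambda>x. frechet_derivative g (at x) b) \<in> S"
  shows "smooth f"
proof -
  have "partials bs f \<in> S" if "set bs \<subseteq> Basis" for bs
    using that by (induction bs) (auto simp: assms(1) closed)
  then show ?thesis
    unfolding smooth_def using diff by blast
qed

lemma partials_append: "partials (bs @ cs) f = partials bs (partials cs f)"
  by (induction bs) auto

lemma smooth_partial:
  assumes "smooth f" "b \<in> Basis"
  shows "smooth (\<lambda>x. frechet_derivative f (at x) b)"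
  unfolding smooth_def
proof (intro allI impI)
  fix bs x assume "set bs \<subseteq> (Basis :: 'a set)"
  then have "set (bs @ [b]) \<subseteq> Basis"
    using assms(2) by simp
  then have "partials (bs @ [b]) f differentiable at x"
    using assms(1) unfolding smooth_def by blast
  then show "partials bs (\<lambda>x. frechet_derivative f (at x) b) differentiable at x"
    by (simp add: partials_append)
qed

lemma smooth_differentiable: "smooth f \<Longrightarrow> f differentiable (at x)"
  unfolding smooth_def by (metis empty_set empty_subsetI partials.simps(1))

lemma smooth_has_derivative: "smooth f \<Longrightarrow> (f has_derivative frechet_derivative f (at x)) (at x)"
  using smooth_differentiable frechet_derivative_works by blast

lemma smooth_continuous_on: "smooth f \<Longrightarrow> continuous_on S f"
  by (meson continuous_at_imp_continuous_on differentiable_imp_continuous_within smooth_differentiable)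

lemma smooth_measurable: "smooth f \<Longrightarrow> f \<in> borel_measurable borel"
  by (rule borel_measurable_continuous_onI) (rule smooth_continuous_on)

text \<open>The algebra of functions generated by \<open>H\<close>. By the product rule, all of it is smooth as soon as the
  partial derivatives of the generators stay in it.\<close>
inductive_set generated ::
  "('a::euclidean_space \<Rightarrow> 'b::real_normed_field) set \<Rightarrow> ('a \<Rightarrow> 'b) set" for H where
  base: "h \<in> H \<Longrightarrow> h \<in> generated H"
| const: "(\<lambda>_. c) \<in> generated H"
| add: "f \<in> generated H \<Longrightarrow> g \<in> generated H \<Longrightarrow> (\<lambda>x. f x + g x) \<in> generated H"
| mult: "f \<in> generated H \<Longrightarrow> g \<in> generated H \<Longrightarrow> (\<lambda>x. f x * g x) \<in> generated H"

lemma smooth_generated: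
  fixes f :: "'a::euclidean_space \<Rightarrow> 'b::real_normed_field"
  assumes "f \<in> generated H"
    and deriv: "\<And>h. h \<in> H \<Longrightarrow> \<exists>h'. (\<forall>x. (h has_derivative h' x) (at x)) \<and>
        (\<forall>b\<in>Basis. (\<lambda>x. h' x b) \<in> generated H)"
  shows "smooth f"
proof (rule smooth_coinduct[OF assms(1)])
  have key: "\<exists>g'. (\<forall>x. (g has_derivative g' x) (at x)) \<and>
        (\<forall>b\<in>Basis. (\<lambda>x. g' x b) \<in> generated H)" if "g \<in> generated H" for g
    using that
  proof induction
    case (base h)
    then show ?case by (rule deriv)
  next
    case (const c)
    then show ?case by (intro exI[of _ "\<lambda>x h. 0"]) (auto intro: generated.const)
  next
    case (add f g)
    then obtain f' g' where
      "\<And>x. (f has_derivative f' x) (at x)" "\<And>b. b \<in> Basis \<Longrightarrow> (\<lambda>x. f' x b) \<in> generated H"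
      "\<And>x. (g has_derivative g' x) (at x)" "\<And>b. b \<in> Basis \<Longrightarrow> (\<lambda>x. g' x b) \<in> generated H"
      by blast
    then show ?case
      by (intro exI[of _ "\<lambda>x h. f' x h + g' x h"]) (auto intro!: generated.add has_derivative_add)
  next
    case (mult f g)
    then obtain f' g' where
      "\<And>x. (f has_derivative f' x) (at x)" "\<And>b. b \<in> Basis \<Longrightarrow> (\<lambda>x. f' x b) \<in> generated H"
      "\<And>x. (g has_derivative g' x) (at x)" "\<And>b. b \<in> Basis \<Longrightarrow> (\<lambda>x. g' x b) \<in> generated H"
      by blast
    with mult.hyps show ?case
      by (intro exI[of _ "\<lambda>x h. f x * g' x h + f' x h * g x"])
        (auto intro!: generated.add generated.mult has_derivative_mult)
  qed
  fix g b x
  assume "g \<in> generated H"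
  then obtain g' where g': "\<And>x. (g has_derivative g' x) (at x)"
      "\<And>b. b \<in> Basis \<Longrightarrow> (\<lambda>x. g' x b) \<in> generated H"
    using key by blast
  show "g differentiable at x"
    using g' differentiable_def by blast
  have "frechet_derivative g (at x) = g' x" for x
    using g'(1) frechet_derivative_at by metis
  then show "(\<lambda>x. frechet_derivative g (at x) b) \<in> generated H" if "b \<in> Basis"
    using g'(2)[OF that] by simp
qed

lemma smooth_generated_by_smooth:
  fixes f :: "'a::euclidean_space \<Rightarrow> 'b::real_normed_field"
  assumes "f \<in> generated (Collect smooth)"
  shows "smooth f"
proof (rule smooth_generated[OF assms])
  fix h :: "'a \<Rightarrow> 'b" assume "h \<in> Collect smooth"
  then have "smooth h" by simp
  then show "\<exists>h'. (\<forall>x. (h has_derivative h' x) (at x)) \<and>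
        (\<forall>b\<in>Basis. (\<lambda>x. h' x b) \<in> generated (Collect smooth))"
    by (intro exI[of _ "\<lambda>x. frechet_derivative h (at x)"])
      (auto intro: generated.base smooth_partial smooth_has_derivative)
qed

lemma
  fixes f g :: "'a::euclidean_space \<Rightarrow> 'b::real_normed_field"
  shows smooth_const: "smooth (\<lambda>_::'a. c::'b)"
    and smooth_add: "smooth f \<Longrightarrow> smooth g \<Longrightarrow> smooth (\<lambda>x. f x + g x)"
    and smooth_mult: "smooth f \<Longrightarrow> smooth g \<Longrightarrow> smooth (\<lambda>x. f x * g x)"
proof -
  show "smooth (\<lambda>_::'a. c::'b)"
    by (rule smooth_generated_by_smooth) (rule generated.const)
  assume fg: "smooth f" "smooth g"
  then have *: "f \<in> generated (Collect smooth)" "g \<in> generated (Collect smooth)"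
    by (simp_all add: generated.base)
  show "smooth (\<lambda>x. f x + g x)"
    by (rule smooth_generated_by_smooth) (rule generated.add[OF *])
  show "smooth (\<lambda>x. f x * g x)"
    by (rule smooth_generated_by_smooth) (rule generated.mult[OF *])
qed

lemma smooth_diff:
  fixes f g :: "'a::euclidean_space \<Rightarrow> 'b::real_normed_field"
  assumes "smooth f" "smooth g" shows "smooth (\<lambda>x. f x - g x)"
  using smooth_add[OF assms(1) smooth_mult[OF smooth_const[of "-1"] assms(2)]] by simp

lemma smooth_prod:
  fixes f :: "'i \<Rightarrow> 'a::euclidean_space \<Rightarrow> 'b::real_normed_field"
  assumes "\<And>i. i \<in> I \<Longrightarrow> smooth (f i)"
  shows "smooth (\<lambda>x. \<Prod>i\<in>I. f i x)"
  using assms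
  by (induction I rule: infinite_finite_induct) (simp_all add: smooth_const smooth_mult)

lemma smooth_sum:
  fixes f :: "'i \<Rightarrow> 'a::euclidean_space \<Rightarrow> 'b::real_normed_field"
  assumes "\<And>i. i \<in> I \<Longrightarrow> smooth (f i)"
  shows "smooth (\<lambda>x. \<Sum>i\<in>I. f i x)"
  using assms
  by (induction I rule: infinite_finite_induct) (simp_all add: smooth_const smooth_add)

lemma smooth_linear:
  assumes "bounded_linear (l :: 'a::euclidean_space \<Rightarrow> 'b::real_normed_field)"
  shows "smooth l"
  by (rule smooth_generated[of _ "{l}"])
    (use assms in \<open>auto intro!: generated.base generated.const bounded_linear_imp_has_derivative exI[of _ "\<lambda>x. l"]\<close>)

lemma smooth_cis: "smooth (\<lambda>x::'a::euclidean_space. exp (\<i> * of_real (y \<bullet> x)))"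
proof (rule smooth_generated)
  let ?e = "\<lambda>x. exp (\<i> * complex_of_real (y \<bullet> x))"
  show "?e \<in> generated {?e}"
    by (rule generated.base) simp
  have "(?e has_derivative (\<lambda>k. ?e x * (\<i> * of_real (y \<bullet> k)))) (at x)" for x
    by (rule has_derivative_eq_rhs,
        rule has_derivative_compose[OF _ DERIV_exp[unfolded has_field_derivative_def]],
        (rule derivative_intros)+) (simp add: fun_eq_iff)
  moreover have "(\<lambda>x. ?e x * (\<i> * of_real (y \<bullet> b))) \<in> generated {?e}" for b
    by (rule generated.mult[OF generated.base generated.const]) simp
  ultimately show "\<exists>h'. (\<forall>x. (h has_derivative h' x) (at x)) \<and> (\<forall>b\<in>Basis. (\<lambda>x. h' x b) \<in> generated {?e})"
    if "h \<in> {?e}" for h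
    using that by (intro exI[of _ "\<lambda>x k. ?e x * (\<i> * of_real (y \<bullet> k))"]) simp
qed

lemma real_smooth_has_field_derivative:
  assumes "smooth (\<theta> :: real \<Rightarrow> real)"
  shows "\<exists>\<theta>'. smooth \<theta>' \<and> (\<forall>t. (\<theta> has_field_derivative \<theta>' t) (at t))"
proof (intro exI conjI allI)
  show "smooth (\<lambda>t. frechet_derivative \<theta> (at t) 1)"
    using assms smooth_partial by force
  fix t
  have "bounded_linear (frechet_derivative \<theta> (at t))"
    using smooth_has_derivative[OF assms] has_derivative_bounded_linear by blast
  then have "frechet_derivative \<theta> (at t) h = frechet_derivative \<theta> (at t) 1 * h" for h
    using linear_cmul[OF bounded_linear.linear, of "frechet_derivative \<theta> (at t)" h 1]
    by (simp add: mult.commute)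
  then have "frechet_derivative \<theta> (at t) = (*) (frechet_derivative \<theta> (at t) 1)"
    by blast
  then show "(\<theta> has_field_derivative frechet_derivative \<theta> (at t) 1) (at t)"
    unfolding has_field_derivative_def using smooth_has_derivative[OF assms, of t] by simp
qed

text \<open>The generators \<open>\<theta>(v \<bullet> x + c)\<close>, for all smooth \<open>\<theta>\<close> at once, form a suitable class, because a partial
  derivative only replaces \<open>\<theta>\<close> by a multiple of \<open>\<theta>'\<close>.\<close>
lemma smooth_ridge:
  fixes v :: "'a::euclidean_space"
  assumes "smooth (\<theta> :: real \<Rightarrow> real)"
  shows "smooth (\<lambda>x. complex_of_real (\<theta> (v \<bullet> x + c)))"
proof -
  let ?H = "{\<lambda>x. complex_of_real (\<theta> (v \<bullet> x + c)) |\<theta>. smooth \<theta>}"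
  have *: "\<exists>h'. (\<forall>x. (h has_derivative h' x) (at x)) \<and> (\<forall>b\<in>Basis. (\<lambda>x. h' x b) \<in> generated ?H)"
    if "h \<in> ?H" for h
  proof -
    from that obtain \<theta> where \<theta>: "smooth \<theta>" and h: "h = (\<lambda>x. complex_of_real (\<theta> (v \<bullet> x + c)))"
      by blast
    obtain \<theta>' where \<theta>': "smooth \<theta>'" "\<And>t. (\<theta> has_field_derivative \<theta>' t) (at t)"
      using real_smooth_has_field_derivative[OF \<theta>] by blast
    have "(h has_derivative (\<lambda>k. complex_of_real (\<theta>' (v \<bullet> x + c)) * complex_of_real (v \<bullet> k))) (at x)" for x
      unfolding h
      by (rule has_derivative_eq_rhs,
          rule has_derivative_of_real, rule has_derivative_compose[OF _ \<theta>'(2)[unfolded has_field_derivative_def]])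
        (auto intro!: derivative_eq_intros)
    moreover have "(\<lambda>x. complex_of_real (\<theta>' (v \<bullet> x + c)) * complex_of_real (v \<bullet> b)) \<in> generated ?H" for b
      by (rule generated.mult[OF generated.base generated.const]) (use \<theta>'(1) in blast)
    ultimately show ?thesis
      by (intro exI[of _ "\<lambda>x k. complex_of_real (\<theta>' (v \<bullet> x + c)) * complex_of_real (v \<bullet> k)"]) blast
  qed
  show ?thesis
    by (rule smooth_generated[of _ ?H]) ((use assms in \<open>force intro!: generated.base\<close>), (use * in blast))
qed

text \<open>A partial derivative of \<open>\<theta>(\<bar>x\<bar>) / \<bar>x\<bar>\<^sup>k\<close> is \<open>\<theta>'(\<bar>x\<bar>) x\<^sub>b / \<bar>x\<bar>\<^sup>k\<^sup>+\<^sup>1 - k \<theta>(\<bar>x\<bar>) x\<^sub>b / \<bar>x\<bar>\<^sup>k\<^sup>+\<^sup>2\<close>, so functions of this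
  form and the coordinates generate an algebra closed under partial derivatives. As \<open>\<theta>\<close> vanishes near
  the origin, so do these functions, and the singularity of the norm does no harm.\<close>
lemma smooth_radial:
  assumes "smooth (\<theta> :: real \<Rightarrow> real)" "\<delta> > 0" "\<And>t. t < \<delta> \<Longrightarrow> \<theta> t = 0"
  shows "smooth (\<lambda>x::'a::euclidean_space. complex_of_real (\<theta> (norm x)))"
proof -
  let ?h = "\<lambda>\<theta> k. \<lambda>x::'a. complex_of_real (\<theta> (norm x) / norm x ^ k)"
  let ?H = "{?h \<theta> k |\<theta> k. smooth \<theta> \<and> (\<forall>t<\<delta>. \<theta> t = 0)} \<union> {\<lambda>x. complex_of_real (x \<bullet> b) |b. True}"
  have *: "\<exists>h'. (\<forall>x. (h has_derivative h' x) (at x)) \<and> (\<forall>b\<in>Basis. (\<lambda>x. h' x b) \<in> generated ?H)"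
    if "h \<in> ?H" for h
  proof (cases "h \<in> {\<lambda>x. complex_of_real (x \<bullet> b) |b. True}")
    case True
    then obtain b where "h = (\<lambda>x. complex_of_real (x \<bullet> b))" by blast
    then show ?thesis
      by (intro exI[of _ "\<lambda>x k. complex_of_real (k \<bullet> b)"])
        (auto intro: generated.const intro!: derivative_eq_intros)
  next
    case False
    with that obtain \<theta> k where \<theta>: "smooth \<theta>" "\<And>t. t < \<delta> \<Longrightarrow> \<theta> t = 0"
      and h: "h = ?h \<theta> k"
      by blast
    obtain \<theta>' where \<theta>': "smooth \<theta>'" "\<And>t. (\<theta> has_field_derivative \<theta>' t) (at t)"
      using real_smooth_has_field_derivative[OF \<theta>(1)] by blast
    have \<theta>'0: "\<theta>' t = 0" if "t < \<delta>" for t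
    proof -
      have "((\<lambda>_. 0) has_field_derivative \<theta>' t) (at t)"
        by (rule has_field_derivative_transform_within_open[OF \<theta>'(2), of "{..<\<delta>}"])
          (use that \<theta>(2) in auto)
      then show ?thesis using DERIV_const DERIV_unique by blast
    qed
    define D where "D x l = ?h \<theta>' (k + 1) x * of_real (x \<bullet> l) +
        of_real (- real k) * (?h \<theta> (k + 2) x * of_real (x \<bullet> l))" for x l
    have "(h has_derivative D x) (at x)" for x
    proof (cases "norm x < \<delta>")
      case True
      have "((\<lambda>_. 0) has_derivative (\<lambda>_. 0)) (at x)" by simp
      then have "(h has_derivative (\<lambda>_. 0)) (at x)"
        by (rule has_derivative_transform_within_open[of _ _ _ _ "{x. norm x < \<delta>}"])
          (use True \<theta>(2) in \<open>auto simp: h open_Collect_less continuous_on_norm\<close>)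
      moreover have "D x = (\<lambda>_. 0)"
        using True \<theta>(2) \<theta>'0 by (auto simp: D_def)
      ultimately show ?thesis by simp
    next
      case False
      then have "x \<noteq> 0" using \<open>\<delta> > 0\<close> by auto
      have n: "(norm has_derivative (\<lambda>l. (x \<bullet> l) / norm x)) (at x)"
        using has_derivative_norm[OF \<open>x \<noteq> 0\<close>]
        by (simp add: sgn_div_norm divide_inverse inner_commute mult.commute)
      have g: "((\<lambda>t. \<theta> t / t ^ k) has_field_derivative
           \<theta>' (norm x) / norm x ^ k - real k * \<theta> (norm x) / norm x ^ (k + 1)) (at (norm x))"
      proof (rule DERIV_cong)
        show "((\<lambda>t. \<theta> t / t ^ k) has_field_derivative (\<theta>' (norm x) * norm x ^ k -
            \<theta> (norm x) * (real k * norm x ^ (k - 1))) / (norm x ^ k * norm x ^ k)) (at (norm x))"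
          using \<open>x \<noteq> 0\<close> by (auto intro!: derivative_eq_intros \<theta>'(2))
        have "real k * norm x ^ (k - 1) = real k * norm x ^ k / norm x"
          using \<open>x \<noteq> 0\<close> by (cases k) auto
        then show "(\<theta>' (norm x) * norm x ^ k - \<theta> (norm x) * (real k * norm x ^ (k - 1))) /
            (norm x ^ k * norm x ^ k) =
            \<theta>' (norm x) / norm x ^ k - real k * \<theta> (norm x) / norm x ^ (k + 1)"
          using \<open>x \<noteq> 0\<close> by (auto simp: field_simps)
      qed
      show ?thesis
        unfolding h
        by (rule has_derivative_eq_rhs, rule has_derivative_of_real,
          rule has_derivative_compose[OF n g[unfolded has_field_derivative_def]])
         (use \<open>x \<noteq> 0\<close> in \<open>auto simp: D_def fun_eq_iff field_simps simp flip: of_real_mult of_real_add of_real_minus of_real_diff\<close>)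
    qed
    moreover have "(\<lambda>x. D x b) \<in> generated ?H" for b
      unfolding D_def
      by (intro generated.add generated.mult generated.const; rule generated.base)
        (use \<theta> \<theta>' \<theta>'0 in blast)+
    ultimately show ?thesis by blast
  qed
  show ?thesis
  proof (rule smooth_generated[of _ ?H])
    have "?h \<theta> 0 \<in> ?H"
      using assms by blast
    then have "?h \<theta> 0 \<in> generated ?H"
      by (rule generated.base)
    then show "(\<lambda>x::'a. complex_of_real (\<theta> (norm x))) \<in> generated ?H"
      by simp
  qed (fact *)
qed

lemma smooth_scale:
  fixes f :: "'a::euclidean_space \<Rightarrow> 'b::real_normed_field"
  assumes "smooth f"
  shows "smooth (\<lambda>x. f (c *\<^sub>R x))"
proof -
  let ?H = "{\<lambda>x. f (c *\<^sub>R x) |f. smooth (f :: 'a \<Rightarrow> 'b)}"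
  have *: "\<exists>h'. (\<forall>x. (h has_derivative h' x) (at x)) \<and> (\<forall>b\<in>Basis. (\<lambda>x. h' x b) \<in> generated ?H)"
    if "h \<in> ?H" for h
  proof -
    from that obtain f where f: "smooth f" and h: "h = (\<lambda>x. f (c *\<^sub>R x))"
      by blast
    have "(h has_derivative (\<lambda>k. of_real c * frechet_derivative f (at (c *\<^sub>R x)) k)) (at x)" for x
    proof -
      have "(h has_derivative (\<lambda>k. frechet_derivative f (at (c *\<^sub>R x)) (c *\<^sub>R k))) (at x)"
        unfolding h
        by (rule has_derivative_compose[OF _ smooth_has_derivative[OF f]]) (auto intro!: derivative_eq_intros)
      moreover have "frechet_derivative f (at (c *\<^sub>R x)) (c *\<^sub>R k) =
          of_real c * frechet_derivative f (at (c *\<^sub>R x)) k" for k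
        using linear_cmul[OF linear_frechet_derivative[OF smooth_differentiable[OF f]]]
        by (simp add: scaleR_conv_of_real)
      ultimately show ?thesis
        by simp
    qed
    moreover have "(\<lambda>x. of_real c * frechet_derivative f (at (c *\<^sub>R x)) b) \<in> generated ?H" if "b \<in> Basis" for b
      by (rule generated.mult[OF generated.const generated.base])
        (rule CollectI, rule exI[of _ "\<lambda>x. frechet_derivative f (at x) b"], simp add: smooth_partial[OF f that])
    ultimately show ?thesis
      by (intro exI[of _ "\<lambda>x k. of_real c * frechet_derivative f (at (c *\<^sub>R x)) k"]) blast
  qed
  show ?thesis
  proof (rule smooth_generated[of _ ?H])
    show "(\<lambda>x. f (c *\<^sub>R x)) \<in> generated ?H"
      by (rule generated.base) (use assms in blast)
  qed (fact *)
qed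

section \<open>Test functions\<close>

lemma test_function_iff:
  "test_function f \<longleftrightarrow> smooth f \<and> (\<exists>R. \<forall>x. R < norm x \<longrightarrow> f x = 0)"
proof -
  have "compact (closure {x. f x \<noteq> 0}) \<longleftrightarrow> (\<exists>R. \<forall>x. R < norm x \<longrightarrow> f x = 0)"
    by (simp add: compact_closure bounded_iff) (meson not_le)
  then show ?thesis
    by (simp add: test_function_def)
qed

lemma test_function_smooth: "test_function f \<Longrightarrow> smooth f"
  by (simp add: test_function_def)

lemma test_function_partial:
  assumes "test_function f" "b \<in> Basis"
  shows "test_function (\<lambda>x. frechet_derivative f (at x) b)"
proof -
  obtain R where R: "\<And>x. R < norm x \<Longrightarrow> f x = 0" and f: "smooth f"
    using assms(1) unfolding test_function_iff by blast
  have "frechet_derivative f (at x) b = 0" if "R < norm x" for x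
  proof -
    have "((\<lambda>_. 0) has_derivative frechet_derivative f (at x)) (at x)"
      by (rule has_derivative_transform_within_open[OF smooth_has_derivative[OF f], of "{x. R < norm x}"])
        (use that R in \<open>auto intro!: open_Collect_less continuous_intros\<close>)
    then have "frechet_derivative f (at x) = (\<lambda>_. 0)"
      using has_derivative_const has_derivative_unique by blast
    then show ?thesis by simp
  qed
  with smooth_partial[OF f assms(2)] show ?thesis
    unfolding test_function_iff by blast
qed

lemma test_function_mult:
  assumes "smooth g" "test_function f"
  shows "test_function (\<lambda>x. g x * f x)"
  using assms smooth_mult unfolding test_function_iff by (metis mult_zero_right)

lemma test_function_sum:
  assumes "\<And>i. i \<in> I \<Longrightarrow> test_function (f i)"
  shows "test_function (\<lambda>x. \<Sum>i\<in>I. f i x)"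
  using assms
proof (induction I rule: infinite_finite_induct)
  case (insert i I)
  obtain R S where "\<And>x. R < norm x \<Longrightarrow> f i x = 0" "\<And>x. S < norm x \<Longrightarrow> (\<Sum>i\<in>I. f i x) = 0"
    using insert unfolding test_function_iff by (metis insertCI)
  then have "\<forall>x. max R S < norm x \<longrightarrow> (\<Sum>i\<in>insert i I. f i x) = 0"
    using insert.hyps by simp
  moreover have "smooth (\<lambda>x. \<Sum>i\<in>insert i I. f i x)"
    using insert.prems test_function_smooth by (blast intro: smooth_sum)
  ultimately show ?case unfolding test_function_iff by blast
qed (auto simp: test_function_iff smooth_const)

lemma test_function_integrable:
  assumes "test_function f"
  shows "integrable lborel f"
proof -
  obtain R where R: "\<And>x. R < norm x \<Longrightarrow> f x = 0" and f: "smooth f"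
    using assms(1) unfolding test_function_iff by blast
  have "integrable lborel (\<lambda>x. indicator (cball 0 R) x *\<^sub>R f x)"
    by (rule borel_integrable_compact) (use f smooth_continuous_on in auto)
  also have "(\<lambda>x. indicator (cball 0 R) x *\<^sub>R f x) = f"
    using R by (auto simp: fun_eq_iff indicator_def not_le)
  finally show ?thesis .
qed

lemma test_function_bounded:
  assumes "test_function f"
  shows "\<exists>M. \<forall>x. norm (f x) \<le> M"
proof -
  obtain R where R: "\<And>x. R < norm x \<Longrightarrow> f x = 0" and f: "smooth f"
    using assms(1) unfolding test_function_iff by blast
  have "compact (f ` cball 0 R)"
    using f by (intro compact_continuous_image smooth_continuous_on) auto
  then obtain M where M: "\<And>x. x \<in> cball 0 R \<Longrightarrow> norm (f x) \<le> M"
    using compact_imp_bounded bounded_iff by (metis imageI)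
  have "norm (f x) \<le> max M 0" for x
    using M[of x] R[of x] by (cases "norm x \<le> R") auto
  then show ?thesis by blast
qed

text \<open>Integration by parts without boundary terms. The integral of a difference quotient of \<open>f\<close> is \<open>0\<close> by
  translation invariance; the quotients converge to the partial derivative and are bounded by its
  supremum on a fixed ball, so dominated convergence applies.\<close>
lemma integral_partial_test_function:
  fixes f :: "'a::euclidean_space \<Rightarrow> complex"
  assumes f: "test_function f" and b: "b \<in> Basis"
  shows "(\<integral>x. frechet_derivative f (at x) b \<partial>lborel) = 0"
proof -
  let ?D = "\<lambda>x. frechet_derivative f (at x) b"
  obtain R where R: "\<And>x. R < norm x \<Longrightarrow> f x = 0" and sf: "smooth f"
    using f unfolding test_function_iff by blast
  obtain M where M: "\<And>x. norm (?D x) \<le> M"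
    using test_function_bounded[OF test_function_partial[OF f b]] by blast
  have M0: "0 \<le> M" using M[of 0] norm_ge_zero order_trans by blast
  have fm[measurable]: "f \<in> borel_measurable borel"
    using sf by (rule smooth_measurable)
  define h where "h k = 1 / real (Suc k)" for k
  have h: "0 < h k" "h k \<le> 1" for k by (auto simp: h_def)
  define s where "s k x = (f (x + h k *\<^sub>R b) - f x) /\<^sub>R h k" for k x
  have lim: "(\<lambda>k. s k x) \<longlonglongrightarrow> ?D x" for x
  proof -
    let ?q = "\<lambda>v. norm (f (x + v) - f x - frechet_derivative f (at x) v) / norm v"
    have "((\<lambda>v. ?q v) \<longlongrightarrow> 0) (at 0)"
      using smooth_has_derivative[OF sf, of x] unfolding has_derivative_at by blast
    moreover have "filterlim (\<lambda>k. h k *\<^sub>R b) (at 0) sequentially"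
    proof (rule filterlim_atI)
      have "h \<longlonglongrightarrow> 0" unfolding h_def using LIMSEQ_inverse_real_of_nat by (simp add: inverse_eq_divide)
      then show "(\<lambda>k. h k *\<^sub>R b) \<longlonglongrightarrow> 0"
        using tendsto_scaleR[of h 0 sequentially "\<lambda>_. b" b] by simp
      show "\<forall>\<^sub>F k in sequentially. h k *\<^sub>R b \<noteq> 0"
        using h(1) b nonzero_Basis by (auto simp: less_imp_neq[symmetric] intro!: always_eventually)
    qed
    ultimately have "(\<lambda>k. ?q (h k *\<^sub>R b)) \<longlonglongrightarrow> 0"
      by (rule filterlim_compose)
    also have "(\<lambda>k. ?q (h k *\<^sub>R b)) = (\<lambda>k. norm (s k x - ?D x))"
    proof
      fix k
      have "frechet_derivative f (at x) (h k *\<^sub>R b) = h k *\<^sub>R ?D x"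
        using linear_cmul[OF linear_frechet_derivative[OF smooth_differentiable[OF sf]]] .
      then have "s k x - ?D x = (f (x + h k *\<^sub>R b) - f x - frechet_derivative f (at x) (h k *\<^sub>R b)) /\<^sub>R h k"
        using h(1)[of k] by (simp add: s_def scaleR_diff_right)
      then show "?q (h k *\<^sub>R b) = norm (s k x - ?D x)"
        using h(1)[of k] b by (simp add: divide_inverse)
    qed
    finally show ?thesis
      using tendsto_norm_zero_iff LIM_zero_iff by blast
  qed
  have bound: "norm (s k x) \<le> indicator (cball 0 (R + 1)) x * M" for k x
  proof (cases "norm x \<le> R + 1")
    case True
    have "norm (f (x + h k *\<^sub>R b) - f (x + 0 *\<^sub>R b)) \<le> M * norm (h k - 0)"
    proof (rule differentiable_bound[of UNIV "\<lambda>t. f (x + t *\<^sub>R b)" "\<lambda>t l. l *\<^sub>R ?D (x + t *\<^sub>R b)"])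
      fix t
      have "((\<lambda>t. f (x + t *\<^sub>R b)) has_derivative (\<lambda>l. frechet_derivative f (at (x + t *\<^sub>R b)) (l *\<^sub>R b))) (at t)"
        by (rule has_derivative_compose[OF _ smooth_has_derivative[OF sf]]) (auto intro!: derivative_eq_intros)
      then show "((\<lambda>t. f (x + t *\<^sub>R b)) has_derivative (\<lambda>l. l *\<^sub>R ?D (x + t *\<^sub>R b))) (at t within UNIV)"
        using linear_cmul[OF linear_frechet_derivative[OF smooth_differentiable[OF sf]]] by simp
      show "onorm (\<lambda>l. l *\<^sub>R ?D (x + t *\<^sub>R b)) \<le> M"
        using M by (intro onorm_le) (simp add: mult.commute[of M] mult_left_mono)
    qed auto
    then show ?thesis
      using True h(1)[of k] by (simp add: s_def pos_divide_le_eq flip: divide_inverse_commute)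
  next
    case False
    have "norm x \<le> norm (x + h k *\<^sub>R b) + norm (h k *\<^sub>R b)"
      using norm_triangle_sub[of x "x + h k *\<^sub>R b"] by simp
    with False h[of k] b have "R < norm (x + h k *\<^sub>R b)" "R < norm x"
      by auto
    then show ?thesis
      using R False by (simp add: s_def)
  qed
  have "integrable lborel (s k)" "(\<integral>x. s k x \<partial>lborel) = 0" for k
  proof -
    have i: "integrable lborel f" using f by (rule test_function_integrable)
    have i2: "integrable lborel (\<lambda>x. f (x + h k *\<^sub>R b))"
      using i integrable_distr_eq[of "(+) (h k *\<^sub>R b)" lborel borel f] by (simp add: lborel_distr_plus add.commute)
    have "(\<integral>x. f (x + h k *\<^sub>R b) \<partial>lborel) = (\<integral>x. f x \<partial>lborel)"
      using integral_distr[of "(+) (h k *\<^sub>R b)" lborel borel f] by (simp add: lborel_distr_plus add.commute)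
    with i i2 show "integrable lborel (s k)" "(\<integral>x. s k x \<partial>lborel) = 0"
      unfolding s_def by simp_all
  qed
  moreover have "(\<lambda>k. \<integral>x. s k x \<partial>lborel) \<longlonglongrightarrow> (\<integral>x. ?D x \<partial>lborel)"
  proof (rule integral_dominated_convergence)
    show "?D \<in> borel_measurable lborel"
      using smooth_measurable[OF smooth_partial[OF sf b]] by simp
    show "integrable lborel (\<lambda>x::'a. indicator (cball 0 (R + 1)) x * M)"
      using borel_integrable_compact[of "cball (0::'a) (R + 1)" "\<lambda>_. M"] by (simp add: mult.commute)
    show "s k \<in> borel_measurable lborel" for k
      unfolding s_def by measurable
  qed (use lim bound in auto)
  ultimately show ?thesis
    by (simp add: LIMSEQ_const_iff)
qed

section \<open>The inverse Fourier transform of a test function is a Schwartz function\<close>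

lemma integrable_mult_bounded:
  fixes f g :: "'a \<Rightarrow> complex"
  assumes "integrable M f" "g \<in> borel_measurable M" "\<And>x. norm (g x) \<le> C"
  shows "integrable M (\<lambda>x. g x * f x)"
proof (rule Bochner_Integration.integrable_bound)
  show "integrable M (\<lambda>x. C * norm (f x))"
    using assms(1) by simp
  show "AE x in M. norm (g x * f x) \<le> norm (C * norm (f x))"
  proof (intro AE_I2)
    fix x
    have "0 \<le> C" using assms(3)[of x] norm_ge_zero order_trans by blast
    then show "norm (g x * f x) \<le> norm (C * norm (f x))"
      using assms(3)[of x] by (simp add: norm_mult mult_right_mono)
  qed
qed (use assms in \<open>auto intro: borel_measurable_times\<close>)

lemma integrable_iexp_mult:
  fixes f :: "'a::euclidean_space \<Rightarrow> complex"
  assumes "integrable lborel f"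
  shows "integrable lborel (\<lambda>\<xi>. iexp (x \<bullet> \<xi>) * f \<xi>)"
  by (rule integrable_mult_bounded[OF assms, of _ 1]) auto

lemma norm_inv_fourier_le:
  fixes f :: "'a::euclidean_space \<Rightarrow> complex"
  shows "norm (inv_fourier f x) \<le> (2 * pi) powr (- real DIM('a)) * (\<integral>\<xi>. norm (f \<xi>) \<partial>lborel)"
proof -
  have "norm (\<integral>\<xi>. iexp (x \<bullet> \<xi>) * f \<xi> \<partial>lborel) \<le> (\<integral>\<xi>. norm (iexp (x \<bullet> \<xi>) * f \<xi>) \<partial>lborel)"
    by (rule integral_norm_bound)
  then show ?thesis
    by (simp add: inv_fourier_def norm_mult mult_left_mono)
qed

lemma test_function_coord_mult:
  assumes "test_function f"
  shows "test_function (\<lambda>\<xi>. \<i> * of_real (h \<bullet> \<xi>) * f \<xi>)"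
proof (rule test_function_mult[OF _ assms])
  have "bounded_linear (\<lambda>\<xi>. \<i> * complex_of_real (h \<bullet> \<xi>))"
    by (intro bounded_linear_intros bounded_linear_compose[OF bounded_linear_mult_right])
      (auto intro: bounded_linear_compose[OF bounded_linear_of_real] bounded_linear_inner_right)
  then show "smooth (\<lambda>\<xi>. \<i> * complex_of_real (h \<bullet> \<xi>))"
    by (rule smooth_linear)
qed

text \<open>Differentiation under the integral sign, with an explicit remainder: by Taylor's formula for the
  exponential, the error at distance \<open>\<bar>h\<bar>\<close> is at most a constant times \<open>\<bar>h\<bar>\<^sup>2 \<integral>\<bar>\<xi>\<bar>\<^sup>2 \<bar>f(\<xi>)\<bar> d\<xi>\<close>.\<close>
lemma inv_fourier_has_derivative:
  fixes f :: "'a::euclidean_space \<Rightarrow> complex"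
  assumes f: "test_function f"
  shows "(inv_fourier f has_derivative (\<lambda>h. inv_fourier (\<lambda>\<xi>. \<i> * of_real (h \<bullet> \<xi>) * f \<xi>) x)) (at x)"
proof -
  let ?k = "(2 * pi) powr (- real DIM('a))"
  let ?D = "\<lambda>h. inv_fourier (\<lambda>\<xi>. \<i> * of_real (h \<bullet> \<xi>) * f \<xi>) x"
  have i1: "integrable lborel (\<lambda>\<xi>. iexp (y \<bullet> \<xi>) * f \<xi>)" for y
    by (intro integrable_iexp_mult test_function_integrable f)
  have i2: "integrable lborel (\<lambda>\<xi>. iexp (y \<bullet> \<xi>) * (\<i> * of_real (h \<bullet> \<xi>) * f \<xi>))" for y h
    by (intro integrable_iexp_mult test_function_integrable test_function_coord_mult f)
  have fm[measurable]: "f \<in> borel_measurable borel"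
    using f smooth_measurable test_function_smooth by blast
  define J where "J = (\<integral>\<xi>. (norm \<xi>)\<^sup>2 * norm (f \<xi>) \<partial>lborel)"
  have iJ: "integrable lborel (\<lambda>\<xi>. (norm \<xi>)\<^sup>2 * norm (f \<xi>))"
  proof -
    obtain R where R: "\<And>x. R < norm x \<Longrightarrow> f x = 0"
      using f unfolding test_function_iff by blast
    show ?thesis
    proof (rule Bochner_Integration.integrable_bound)
      show "integrable lborel (\<lambda>\<xi>. R\<^sup>2 * norm (f \<xi>))"
        using test_function_integrable[OF f] by simp
      show "AE \<xi> in lborel. norm ((norm \<xi>)\<^sup>2 * norm (f \<xi>)) \<le> norm (R\<^sup>2 * norm (f \<xi>))"
      proof (intro AE_I2)
        fix \<xi>
        show "norm ((norm \<xi>)\<^sup>2 * norm (f \<xi>)) \<le> norm (R\<^sup>2 * norm (f \<xi>))"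
          using R[of \<xi>] by (cases "norm \<xi> \<le> R") (auto intro!: mult_right_mono power_mono)
      qed
    qed measurable
  qed
  have "linear ?D"
  proof (rule linearI)
    fix h h' c
    show "?D (h + h') = ?D h + ?D h'"
      using Bochner_Integration.integral_add[OF i2[of x h] i2[of x h']]
      by (simp add: inv_fourier_def inner_add_left algebra_simps)
    have "?D (c *\<^sub>R h) = of_real ?k * (\<integral>\<xi>. of_real c * (iexp (x \<bullet> \<xi>) * (\<i> * of_real (h \<bullet> \<xi>) * f \<xi>)) \<partial>lborel)"
      by (simp add: inv_fourier_def mult_ac)
    then show "?D (c *\<^sub>R h) = c *\<^sub>R ?D h"
      by (simp add: inv_fourier_def scaleR_conv_of_real mult_ac)
  qed
  then have bl: "bounded_linear ?D"
    by (simp add: linear_conv_bounded_linear)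
  show ?thesis
  proof (rule has_derivativeI_sandwich[OF zero_less_one bl])
    fix y assume "y \<noteq> x"
    define h where "h = y - x"
    let ?g = "\<lambda>\<xi>. iexp (y \<bullet> \<xi>) * f \<xi> - iexp (x \<bullet> \<xi>) * f \<xi> - iexp (x \<bullet> \<xi>) * (\<i> * of_real (h \<bullet> \<xi>) * f \<xi>)"
    have "(inv_fourier f y - inv_fourier f x) - ?D (y - x) = of_real ?k * (\<integral>\<xi>. ?g \<xi> \<partial>lborel)"
      unfolding h_def[symmetric] inv_fourier_def
      using i1 i2 by (simp add: algebra_simps)
    then have "norm ((inv_fourier f y - inv_fourier f x) - ?D (y - x)) = ?k * norm (\<integral>\<xi>. ?g \<xi> \<partial>lborel)"
      by (simp add: norm_mult)
    also have "norm (\<integral>\<xi>. ?g \<xi> \<partial>lborel) \<le> (\<integral>\<xi>. (norm h)\<^sup>2 * ((norm \<xi>)\<^sup>2 * norm (f \<xi>)) \<partial>lborel)"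
    proof (rule order_trans[OF integral_norm_bound], rule integral_mono)
      show "integrable lborel (\<lambda>\<xi>. norm (?g \<xi>))"
        using i1 i2 by (intro integrable_norm Bochner_Integration.integrable_diff)
      show "integrable lborel (\<lambda>\<xi>. (norm h)\<^sup>2 * ((norm \<xi>)\<^sup>2 * norm (f \<xi>)))"
        using iJ by simp
      fix \<xi>
      have "?g \<xi> = iexp (x \<bullet> \<xi>) * (iexp (h \<bullet> \<xi>) - (\<Sum>k\<le>1. (\<i> * of_real (h \<bullet> \<xi>)) ^ k / fact k)) * f \<xi>"
      proof -
        have "iexp (y \<bullet> \<xi>) = iexp (x \<bullet> \<xi>) * iexp (h \<bullet> \<xi>)"
          unfolding exp_add[symmetric] h_def by (simp add: algebra_simps)
        then show ?thesis by (simp add: algebra_simps)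
      qed
      then have "norm (?g \<xi>) = norm (iexp (h \<bullet> \<xi>) - (\<Sum>k\<le>1. (\<i> * of_real (h \<bullet> \<xi>)) ^ k / fact k)) * norm (f \<xi>)"
        by (simp only: norm_mult) simp
      also have "\<dots> \<le> (\<bar>h \<bullet> \<xi>\<bar> ^ Suc 1 / fact (Suc 1)) * norm (f \<xi>)"
        by (rule mult_right_mono[OF iexp_approx1]) simp
      also have "\<dots> \<le> (\<bar>h \<bullet> \<xi>\<bar>\<^sup>2) * norm (f \<xi>)"
        by (rule mult_right_mono) (auto simp: power2_eq_square)
      also have "\<dots> \<le> (norm h * norm \<xi>)\<^sup>2 * norm (f \<xi>)"
        by (intro mult_right_mono power_mono Cauchy_Schwarz_ineq2) auto
      finally show "norm (?g \<xi>) \<le> (norm h)\<^sup>2 * ((norm \<xi>)\<^sup>2 * norm (f \<xi>))"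
        by (simp add: power_mult_distrib mult_ac)
    qed
    also have "\<dots> = (norm h)\<^sup>2 * J"
      by (simp add: J_def)
    finally have "norm ((inv_fourier f y - inv_fourier f x) - ?D (y - x)) \<le> ?k * ((norm h)\<^sup>2 * J)"
      by (simp add: mult_left_mono)
    then show "norm ((inv_fourier f y - inv_fourier f x) - ?D (y - x)) / norm (y - x) \<le> ?k * J * norm (y - x)"
      using \<open>y \<noteq> x\<close> by (simp add: h_def field_simps power2_eq_square)
  next
    show "((\<lambda>y. ?k * J * norm (y - x)) \<longlongrightarrow> 0) (at x)"
      by (auto intro!: tendsto_eq_intros)
  qed
qed

text \<open>Integration by parts turns multiplication by a coordinate into differentiation of \<open>f\<close>, which again
  is a test function. This is the source of all decay below.\<close>
lemma coord_mult_inv_fourier: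
  fixes f :: "'a::euclidean_space \<Rightarrow> complex"
  assumes f: "test_function f" and b: "b \<in> Basis"
  shows "of_real (x \<bullet> b) * inv_fourier f x = inv_fourier (\<lambda>\<xi>. \<i> * frechet_derivative f (at \<xi>) b) x"
proof -
  let ?F = "\<lambda>\<xi>. iexp (x \<bullet> \<xi>) * f \<xi>"
  let ?D = "\<lambda>\<xi>. frechet_derivative f (at \<xi>) b"
  have "test_function ?F"
    by (intro test_function_mult smooth_cis f)
  then have 0: "(\<integral>\<xi>. frechet_derivative ?F (at \<xi>) b \<partial>lborel) = 0"
    using b by (rule integral_partial_test_function)
  have i1: "integrable lborel ?F"
    by (intro integrable_iexp_mult test_function_integrable f)
  have i2: "integrable lborel (\<lambda>\<xi>. iexp (x \<bullet> \<xi>) * ?D \<xi>)"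
    by (intro integrable_iexp_mult test_function_integrable test_function_partial f b)
  have "frechet_derivative ?F (at \<xi>) b = \<i> * of_real (x \<bullet> b) * ?F \<xi> + iexp (x \<bullet> \<xi>) * ?D \<xi>" for \<xi>
  proof -
    have e: "((\<lambda>\<xi>. iexp (x \<bullet> \<xi>)) has_derivative (\<lambda>k. iexp (x \<bullet> \<xi>) * (\<i> * of_real (x \<bullet> k)))) (at \<xi>)"
      by (rule has_derivative_eq_rhs,
          rule has_derivative_compose[OF _ DERIV_exp[unfolded has_field_derivative_def]],
          (rule derivative_intros)+) (simp add: fun_eq_iff)
    show ?thesis
      using frechet_derivative_at[OF has_derivative_mult[OF e smooth_has_derivative[OF test_function_smooth[OF f]]]]
      by (simp add: fun_eq_iff mult_ac add_ac flip: frechet_derivative_at)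
  qed
  with 0 have "\<i> * of_real (x \<bullet> b) * (\<integral>\<xi>. ?F \<xi> \<partial>lborel) + (\<integral>\<xi>. iexp (x \<bullet> \<xi>) * ?D \<xi> \<partial>lborel) = 0"
    using i1 i2 by simp
  then have "of_real (x \<bullet> b) * (\<integral>\<xi>. ?F \<xi> \<partial>lborel) = \<i> * (\<integral>\<xi>. iexp (x \<bullet> \<xi>) * ?D \<xi> \<partial>lborel)"
    by (simp add: complex_eq_iff algebra_simps)
  moreover have "(\<integral>\<xi>. iexp (x \<bullet> \<xi>) * (\<i> * ?D \<xi>) \<partial>lborel) = \<i> * (\<integral>\<xi>. iexp (x \<bullet> \<xi>) * ?D \<xi> \<partial>lborel)"
    by (simp add: mult.left_commute)
  ultimately show ?thesis
    by (simp add: inv_fourier_def mult.left_commute)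
qed

text \<open>By induction on \<open>k\<close>, for all test functions at once: a factor \<open>1 + \<bar>x\<bar> \<le> 1 + \<Sum>\<^sub>b \<bar>x\<^sub>b\<bar>\<close> is absorbed by
  passing from \<open>f\<close> to its partial derivatives.\<close>
lemma inv_fourier_decay:
  fixes f :: "'a::euclidean_space \<Rightarrow> complex"
  assumes "test_function f"
  shows "\<exists>C. \<forall>x. (1 + norm x) ^ k * norm (inv_fourier f x) \<le> C"
  using assms
proof (induction k arbitrary: f)
  case 0
  then show ?case using norm_inv_fourier_le[of f] by auto
next
  case (Suc k)
  let ?g = "\<lambda>b \<xi>. \<i> * frechet_derivative f (at \<xi>) b"
  obtain C where C: "\<And>x. (1 + norm x) ^ k * norm (inv_fourier f x) \<le> C"
    using Suc.IH[OF Suc.prems] by blast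
  have "\<exists>C. \<forall>x. (1 + norm x) ^ k * norm (inv_fourier (?g b) x) \<le> C" if "b \<in> Basis" for b
    by (intro Suc.IH test_function_mult smooth_const test_function_partial Suc.prems that)
  then obtain D where D: "\<And>b x. b \<in> Basis \<Longrightarrow> (1 + norm x) ^ k * norm (inv_fourier (?g b) x) \<le> D b"
    by metis
  have "(1 + norm x) ^ Suc k * norm (inv_fourier f x) \<le> C + (\<Sum>b\<in>Basis. D b)" for x
  proof -
    let ?w = "(1 + norm x) ^ k"
    have "(1 + norm x) ^ Suc k * norm (inv_fourier f x) = (1 + norm x) * (?w * norm (inv_fourier f x))"
      by simp
    also have "\<dots> \<le> (1 + (\<Sum>b\<in>Basis. \<bar>x \<bullet> b\<bar>)) * (?w * norm (inv_fourier f x))"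
      by (intro mult_right_mono add_left_mono norm_le_l1) simp
    also have "\<dots> = ?w * norm (inv_fourier f x) + (\<Sum>b\<in>Basis. ?w * norm (of_real (x \<bullet> b) * inv_fourier f x))"
      by (simp add: norm_mult sum_distrib_right sum_distrib_left algebra_simps)
    also have "\<dots> = ?w * norm (inv_fourier f x) + (\<Sum>b\<in>Basis. ?w * norm (inv_fourier (?g b) x))"
      using coord_mult_inv_fourier[OF Suc.prems] by simp
    also have "\<dots> \<le> C + (\<Sum>b\<in>Basis. D b)"
      by (intro add_mono C sum_mono D)
    finally show ?thesis .
  qed
  then show ?case by blast
qed

lemma schwartz_inv_fourier:
  fixes f :: "'a::euclidean_space \<Rightarrow> complex"
  assumes "test_function f"
  shows "schwartz (inv_fourier f)"
proof -
  have partials: "\<exists>g. test_function g \<and> partials bs (inv_fourier f) = inv_fourier g" if "set bs \<subseteq> Basis" for bs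
    using that
  proof (induction bs)
    case Nil
    then show ?case using assms by auto
  next
    case (Cons b bs)
    then obtain g where g: "test_function g" "partials bs (inv_fourier f) = inv_fourier g"
      by auto
    have "frechet_derivative (inv_fourier g) (at x) b = inv_fourier (\<lambda>\<xi>. \<i> * of_real (b \<bullet> \<xi>) * g \<xi>) x" for x
      using frechet_derivative_at[OF inv_fourier_has_derivative[OF g(1)], of x] by metis
    then have "partials (b # bs) (inv_fourier f) = inv_fourier (\<lambda>\<xi>. \<i> * of_real (b \<bullet> \<xi>) * g \<xi>)"
      using g(2) by simp
    then show ?case
      using test_function_coord_mult[OF g(1), of b] by blast
  qed
  show ?thesis
    unfolding schwartz_def smooth_def
  proof (intro conjI allI impI)
    fix bs :: "'a list" and x assume "set bs \<subseteq> Basis"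
    then obtain g where "test_function g" "partials bs (inv_fourier f) = inv_fourier g"
      using partials by blast
    then show "partials bs (inv_fourier f) differentiable at x"
      using inv_fourier_has_derivative[of g x] by (simp add: differentiableI)
  next
    fix k and bs :: "'a list" assume "set bs \<subseteq> Basis"
    then obtain g where "test_function g" "partials bs (inv_fourier f) = inv_fourier g"
      using partials by blast
    then show "bdd_above (range (\<lambda>x. (1 + norm x) ^ k * norm (partials bs (inv_fourier f) x)))"
      using inv_fourier_decay[of g k] by (auto simp: bdd_above_def)
  qed
qed

section \<open>Integration over a Euclidean space\<close>

lemma
  fixes f :: "'a::euclidean_space \<Rightarrow> real \<Rightarrow> 'b::{real_normed_field,banach,second_countable_topology}"
  assumes f: "\<And>b. b \<in> Basis \<Longrightarrow> integrable lborel (f b)"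
  shows integrable_lborel_prod: "integrable lborel (\<lambda>x::'a. \<Prod>b\<in>Basis. f b (x \<bullet> b))"
    and integral_lborel_prod:
      "(\<integral>x. (\<Prod>b\<in>Basis. f b ((x::'a) \<bullet> b)) \<partial>lborel) = (\<Prod>b\<in>Basis. \<integral>t. f b t \<partial>lborel)"
proof -
  interpret product_sigma_finite "\<lambda>_::'a. lborel :: real measure" ..
  let ?T = "\<lambda>v. \<Sum>b\<in>Basis. v b *\<^sub>R (b::'a)"
  let ?P = "\<Pi>\<^sub>M b\<in>(Basis::'a set). lborel :: real measure"
  have [measurable]: "b \<in> Basis \<Longrightarrow> f b \<in> borel_measurable borel" for b
    using borel_measurable_integrable[OF f, of b] by simp
  have T[measurable]: "?T \<in> ?P \<rightarrow>\<^sub>M borel" by measurable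
  have F[measurable]: "(\<lambda>x::'a. \<Prod>b\<in>Basis. f b (x \<bullet> b)) \<in> borel_measurable borel" by measurable
  have *: "(\<Prod>b\<in>Basis. f b (?T v \<bullet> b)) = (\<Prod>b\<in>Basis. f b (v b))" for v
    by (intro prod.cong) auto
  show "integrable lborel (\<lambda>x::'a. \<Prod>b\<in>Basis. f b (x \<bullet> b))"
    unfolding lborel_eq[where 'a = 'a] integrable_distr_eq[OF T F] *
    by (intro product_integrable_prod f) auto
  show "(\<integral>x. (\<Prod>b\<in>Basis. f b ((x::'a) \<bullet> b)) \<partial>lborel) = (\<Prod>b\<in>Basis. \<integral>t. f b t \<partial>lborel)"
    unfolding lborel_eq[where 'a = 'a] integral_distr[OF T F] *
    by (intro product_integral_prod f) auto
qed

text \<open>The product of the functions \<open>1 / (1 + x\<^sub>b\<^sup>2)\<close> is integrable by Fubini, and it dominates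
  \<open>(1 + \<bar>x\<bar>)\<^sup>-\<^sup>2\<^sup>n\<close>.\<close>
lemma integrable_decay:
  assumes [measurable]: "f \<in> borel_measurable borel"
    and C: "\<And>x::'a::euclidean_space. (1 + norm x) ^ (2 * DIM('a)) * norm (f x) \<le> C"
  shows "integrable lborel (f :: 'a \<Rightarrow> 'b::{banach,second_countable_topology})"
proof (rule Bochner_Integration.integrable_bound)
  have "integrable lborel (\<lambda>t::real. inverse (1 + t\<^sup>2))"
    using integrable_inverse_1_plus_square by (simp add: set_integrable_def einterval_def)
  then have "integrable lborel (\<lambda>x::'a. \<Prod>b\<in>Basis. inverse (1 + (x \<bullet> b)\<^sup>2))"
    by (rule integrable_lborel_prod)
  then show "integrable lborel (\<lambda>x::'a. C * (\<Prod>b\<in>Basis. inverse (1 + (x \<bullet> b)\<^sup>2)))"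
    by simp
  show "AE x in lborel. norm (f x) \<le> norm (C * (\<Prod>b\<in>Basis. inverse (1 + (x \<bullet> b)\<^sup>2)))"
  proof (intro AE_I2)
    fix x :: 'a
    have pos: "0 < 1 + (x \<bullet> b)\<^sup>2" for b
      by (simp add: add_pos_nonneg)
    have le: "1 + (x \<bullet> b)\<^sup>2 \<le> (1 + norm x)\<^sup>2" if "b \<in> Basis" for b
    proof -
      have "(x \<bullet> b)\<^sup>2 \<le> (norm x)\<^sup>2"
        using Basis_le_norm[OF that, of x] power_mono[of "\<bar>x \<bullet> b\<bar>" "norm x" 2] by simp
      also have "1 + (norm x)\<^sup>2 \<le> (1 + norm x)\<^sup>2"
        by (simp add: power2_eq_square algebra_simps)
      finally show ?thesis by simp
    qed
    have "(\<Prod>b\<in>Basis. 1 + (x \<bullet> b)\<^sup>2) \<le> (\<Prod>b\<in>(Basis::'a set). (1 + norm x)\<^sup>2)"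
      using le pos by (intro prod_mono) (auto intro: less_imp_le)
    also have "\<dots> = (1 + norm x) ^ (2 * DIM('a))"
      by (simp add: power_mult)
    finally have "(\<Prod>b\<in>Basis. 1 + (x \<bullet> b)\<^sup>2) * norm (f x) \<le> C"
      using C[of x] by (meson mult_right_mono norm_ge_zero order_trans)
    moreover have "0 < (\<Prod>b\<in>Basis. 1 + (x \<bullet> b)\<^sup>2)"
      using pos by (intro prod_pos) auto
    ultimately have "norm (f x) \<le> C * inverse (\<Prod>b\<in>Basis. 1 + (x \<bullet> b)\<^sup>2)"
      by (simp add: field_simps)
    also have "inverse (\<Prod>b\<in>Basis. 1 + (x \<bullet> b)\<^sup>2) = (\<Prod>b\<in>Basis. inverse (1 + (x \<bullet> b)\<^sup>2))"
      using prod_inversef[of "\<lambda>b. 1 + (x \<bullet> b)\<^sup>2" Basis] by (simp add: o_def)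
    finally show "norm (f x) \<le> norm (C * (\<Prod>b\<in>Basis. inverse (1 + (x \<bullet> b)\<^sup>2)))"
      by simp
  qed
qed simp

lemma lborel_distr_affine:
  assumes "c \<noteq> 0"
  shows "distr lborel borel (\<lambda>x::'a::euclidean_space. t + c *\<^sub>R x) =
    density lborel (\<lambda>_. ennreal (1 / \<bar>c\<bar> ^ DIM('a)))"
proof -
  let ?D = "distr lborel borel (\<lambda>x::'a. t + c *\<^sub>R x)"
  have "density lborel (\<lambda>_::'a. ennreal (1 / \<bar>c\<bar> ^ DIM('a))) =
      density (density ?D (\<lambda>_. ennreal (\<bar>c\<bar> ^ DIM('a)))) (\<lambda>_. ennreal (1 / \<bar>c\<bar> ^ DIM('a)))"
    by (subst lborel_affine[OF assms, of t]) simp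
  also have "\<dots> = density ?D (\<lambda>_. ennreal (\<bar>c\<bar> ^ DIM('a)) * ennreal (1 / \<bar>c\<bar> ^ DIM('a)))"
    by (subst density_density_eq) auto
  also have "(\<lambda>_::'a. ennreal (\<bar>c\<bar> ^ DIM('a)) * ennreal (1 / \<bar>c\<bar> ^ DIM('a))) = (\<lambda>_. 1)"
    using assms by (simp flip: ennreal_mult)
  finally show ?thesis by (simp add: density_1)
qed

lemma integral_lborel_affine:
  fixes f :: "'a::euclidean_space \<Rightarrow> 'b::{banach,second_countable_topology}"
  assumes "c \<noteq> 0" and [measurable]: "f \<in> borel_measurable borel"
  shows "(\<integral>x. f (t + c *\<^sub>R x) \<partial>lborel) = (1 / \<bar>c\<bar> ^ DIM('a)) *\<^sub>R (\<integral>x. f x \<partial>lborel)"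
proof -
  have "(\<integral>x. f (t + c *\<^sub>R x) \<partial>lborel) = integral\<^sup>L (distr lborel borel (\<lambda>x::'a. t + c *\<^sub>R x)) f"
    by (rule integral_distr[symmetric]) auto
  then show ?thesis
    unfolding lborel_distr_affine[OF assms(1)] by (subst (asm) integral_density) auto
qed

lemma nn_integral_lborel_affine:
  fixes f :: "'a::euclidean_space \<Rightarrow> ennreal"
  assumes "c \<noteq> 0" and [measurable]: "f \<in> borel_measurable borel"
  shows "(\<integral>\<^sup>+x. f (t + c *\<^sub>R x) \<partial>lborel) = ennreal (1 / \<bar>c\<bar> ^ DIM('a)) * (\<integral>\<^sup>+x. f x \<partial>lborel)"
proof -
  have "(\<integral>\<^sup>+x. f (t + c *\<^sub>R x) \<partial>lborel) = nn_integral (distr lborel borel (\<lambda>x::'a. t + c *\<^sub>R x)) f"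
    by (rule nn_integral_distr[symmetric]) auto
  then show ?thesis
    unfolding lborel_distr_affine[OF assms(1)] by (subst (asm) nn_integral_density) (auto simp: nn_integral_cmult)
qed

section \<open>Fourier inversion for test functions\<close>

lemma integral_kernel_swap:
  fixes f g :: "'a::euclidean_space \<Rightarrow> complex" and K :: "'a \<Rightarrow> 'a \<Rightarrow> complex"
  assumes f: "integrable lborel f" and g: "integrable lborel g"
    and [measurable]: "case_prod K \<in> borel_measurable (borel \<Otimes>\<^sub>M borel)"
    and K: "\<And>x y. norm (K x y) \<le> 1"
  shows "(\<integral>x. f x * (\<integral>y. K x y * g y \<partial>lborel) \<partial>lborel) = (\<integral>y. (\<integral>x. K x y * f x \<partial>lborel) * g y \<partial>lborel)"
proof -
  note [measurable] = borel_measurable_integrable[OF f] borel_measurable_integrable[OF g]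
  let ?F = "\<lambda>(x, y). K x y * (f x * g y)"
  have i: "integrable (lborel \<Otimes>\<^sub>M lborel) (\<lambda>(x, y). f x * g y)"
    by (rule lborel_pair.Fubini_integrable) (use f g in \<open>auto simp: norm_mult\<close>)
  have "integrable (lborel \<Otimes>\<^sub>M lborel) (\<lambda>p. case_prod K p * (\<lambda>(x, y). f x * g y) p)"
    by (rule integrable_mult_bounded[OF i, of _ 1]) (use K in auto)
  then have F: "integrable (lborel \<Otimes>\<^sub>M lborel) ?F"
    by (simp add: case_prod_unfold)
  have "(\<integral>x. f x * (\<integral>y. K x y * g y \<partial>lborel) \<partial>lborel) = (\<integral>x. \<integral>y. K x y * (f x * g y) \<partial>lborel \<partial>lborel)"
    by (simp add: mult.left_commute)
  also have "\<dots> = (\<integral>y. \<integral>x. K x y * (f x * g y) \<partial>lborel \<partial>lborel)"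
    using lborel_pair.Fubini_integral[OF F] by simp
  also have "\<dots> = (\<integral>y. (\<integral>x. K x y * f x \<partial>lborel) * g y \<partial>lborel)"
    by (simp add: mult.assoc[symmetric])
  finally show ?thesis .
qed

lemma integral_mult_fourier:
  fixes f g :: "'a::euclidean_space \<Rightarrow> complex"
  assumes "integrable lborel f" "integrable lborel g"
  shows "(\<integral>x. f x * fourier g x \<partial>lborel) = (\<integral>x. fourier f x * g x \<partial>lborel)"
  using integral_kernel_swap[OF assms, of "\<lambda>x y. exp (- \<i> * of_real (x \<bullet> y))"]
  by (simp add: fourier_def inner_commute)

lemma integral_mult_inv_fourier:
  fixes f g :: "'a::euclidean_space \<Rightarrow> complex"
  assumes "integrable lborel f" "integrable lborel g"
  shows "(\<integral>x. f x * inv_fourier g x \<partial>lborel) = (\<integral>x. inv_fourier f x * g x \<partial>lborel)"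
proof -
  let ?k = "complex_of_real ((2 * pi) powr (- real DIM('a)))"
  have "f x * inv_fourier g x = ?k * (f x * (\<integral>\<xi>. iexp (x \<bullet> \<xi>) * g \<xi> \<partial>lborel))"
    and "inv_fourier f x * g x = ?k * ((\<integral>\<xi>. iexp (\<xi> \<bullet> x) * f \<xi> \<partial>lborel) * g x)" for x
    by (simp_all add: inv_fourier_def inner_commute)
  note eq = this
  show ?thesis
    unfolding eq integral_mult_right_zero
    using integral_kernel_swap[OF assms, of "\<lambda>x y. iexp (x \<bullet> y)"] by simp
qed

text \<open>Both sides factor over the coordinates; in dimension one this is the characteristic function of
  the standard normal distribution.\<close>
lemma
  fixes \<xi> :: "'a::euclidean_space"
  shows integrable_gaussian: "integrable lborel (\<lambda>x::'a. exp (- (norm x)\<^sup>2 / 2))"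
    and fourier_gaussian: "(\<integral>x. iexp (\<xi> \<bullet> x) * of_real (exp (- (norm x)\<^sup>2 / 2)) \<partial>lborel) =
        of_real ((2 * pi) powr (real DIM('a) / 2) * exp (- (norm \<xi>)\<^sup>2 / 2))"
proof -
  have norm2: "(norm x)\<^sup>2 = (\<Sum>b\<in>Basis. (x \<bullet> b)\<^sup>2)" for x :: 'a
    unfolding power2_norm_eq_inner by (subst euclidean_inner) (simp add: power2_eq_square)
  have exp_prod: "exp (- (norm x)\<^sup>2 / 2) = (\<Prod>b\<in>Basis. exp (- (x \<bullet> b)\<^sup>2 / 2))" for x :: 'a
    unfolding norm2 by (simp add: sum_negf sum_divide_distrib flip: exp_sum)
  have g1: "integrable lborel (\<lambda>t::real. exp (- t\<^sup>2 / 2))"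
    using integrable_mult_right[OF integrable_std_normal_moment[of 0], of "sqrt (2 * pi)"]
    by (simp add: std_normal_density_def)
  show "integrable lborel (\<lambda>x::'a. exp (- (norm x)\<^sup>2 / 2))"
    unfolding exp_prod by (rule integrable_lborel_prod) (rule g1)
  have gc: "integrable lborel (\<lambda>t::real. iexp (s * t) * of_real (exp (- t\<^sup>2 / 2)))" for s
    by (rule integrable_mult_bounded[of _ _ _ 1]) (use g1 in auto)
  have F1: "(\<integral>t. iexp (s * t) * of_real (exp (- t\<^sup>2 / 2)) \<partial>lborel) = of_real (sqrt (2 * pi) * exp (- s\<^sup>2 / 2))"
    for s :: real
  proof -
    have "of_real (exp (- s\<^sup>2 / 2)) = char std_normal_distribution s"
      by (simp add: char_std_normal_distribution)
    also have "\<dots> = (\<integral>t. std_normal_density t *\<^sub>R iexp (s * t) \<partial>lborel)"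
      unfolding char_def by (subst integral_density) (auto intro: normal_density_nonneg)
    also have "\<dots> = (\<integral>t. of_real (1 / sqrt (2 * pi)) * (iexp (s * t) * of_real (exp (- t\<^sup>2 / 2))) \<partial>lborel)"
      by (intro Bochner_Integration.integral_cong refl)
        (simp add: std_normal_density_def scaleR_conv_of_real mult_ac)
    also have "\<dots> = of_real (1 / sqrt (2 * pi)) * (\<integral>t. iexp (s * t) * of_real (exp (- t\<^sup>2 / 2)) \<partial>lborel)"
      by simp
    finally show ?thesis by (simp add: field_simps)
  qed
  have "(\<integral>x. iexp (\<xi> \<bullet> x) * of_real (exp (- (norm x)\<^sup>2 / 2)) \<partial>lborel) =
      (\<integral>x. (\<Prod>b\<in>Basis. iexp ((\<xi> \<bullet> b) * (x \<bullet> b)) * of_real (exp (- (x \<bullet> b)\<^sup>2 / 2))) \<partial>lborel)"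
  proof (intro Bochner_Integration.integral_cong refl)
    fix x :: 'a
    have "\<i> * complex_of_real (\<xi> \<bullet> x) = (\<Sum>b\<in>Basis. \<i> * complex_of_real ((\<xi> \<bullet> b) * (x \<bullet> b)))"
      by (subst euclidean_inner) (simp add: sum_distrib_left)
    then have "iexp (\<xi> \<bullet> x) = (\<Prod>b\<in>Basis. iexp ((\<xi> \<bullet> b) * (x \<bullet> b)))"
      by (simp add: exp_sum)
    then show "iexp (\<xi> \<bullet> x) * of_real (exp (- (norm x)\<^sup>2 / 2)) =
        (\<Prod>b\<in>Basis. iexp ((\<xi> \<bullet> b) * (x \<bullet> b)) * of_real (exp (- (x \<bullet> b)\<^sup>2 / 2)))"
      unfolding exp_prod by (simp only: prod.distrib of_real_prod)
  qed
  also have "\<dots> = (\<Prod>b\<in>(Basis::'a set). of_real (sqrt (2 * pi) * exp (- (\<xi> \<bullet> b)\<^sup>2 / 2)))"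
    by (subst integral_lborel_prod) (auto simp only: F1 gc)
  also have "\<dots> = of_real (sqrt (2 * pi) ^ DIM('a) * exp (- (norm \<xi>)\<^sup>2 / 2))"
    unfolding exp_prod by (simp add: prod.distrib)
  also have "sqrt (2 * pi) ^ DIM('a) = (2 * pi) powr (real DIM('a) / 2)"
    by (simp add: powr_half_sqrt[symmetric] powr_powr flip: powr_realpow)
  finally show "(\<integral>x. iexp (\<xi> \<bullet> x) * of_real (exp (- (norm x)\<^sup>2 / 2)) \<partial>lborel) =
        of_real ((2 * pi) powr (real DIM('a) / 2) * exp (- (norm \<xi>)\<^sup>2 / 2))" .
qed

lemma inv_fourier_integrable:
  fixes f :: "'a::euclidean_space \<Rightarrow> complex"
  assumes "test_function f"
  shows "integrable lborel (inv_fourier f)"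
proof -
  have "inv_fourier f \<in> borel_measurable borel"
    using schwartz_inv_fourier[OF assms] smooth_measurable schwartz_def by blast
  then show ?thesis
    using inv_fourier_decay[OF assms, of "2 * DIM('a)"] integrable_decay by blast
qed

text \<open>The Fourier integral is regularised by the Gaussian factors \<open>g(x / (k+1))\<close>. With such a factor, the
  transform can be moved from \<open>f\<close> to the explicit function \<open>h k\<close>, whose inverse transform is a Gaussian
  concentrated at \<open>y\<close>. As \<open>k \<rightarrow> \<infinity>\<close>, one side tends to the Fourier integral and the other to \<open>f y\<close>.\<close>
lemma fourier_inv_fourier:
  fixes f :: "'a::euclidean_space \<Rightarrow> complex"
  assumes f: "test_function f"
  shows "fourier (inv_fourier f) y = f y"
proof -
  obtain M where M: "\<And>x. norm (f x) \<le> M"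
    using test_function_bounded[OF f] by blast
  let ?n = "DIM('a)"
  let ?g = "\<lambda>x::'a. complex_of_real (exp (- (norm x)\<^sup>2 / 2))"
  let ?k = "\<lambda>k. real (Suc k)"
  let ?c = "(2 * pi) powr (- real ?n / 2)"
  define h where "h k x = exp (- \<i> * of_real (x \<bullet> y)) * ?g ((1 / ?k k) *\<^sub>R x)" for k x
  have [measurable]: "f \<in> borel_measurable borel" "inv_fourier f \<in> borel_measurable borel"
    using f borel_measurable_integrable inv_fourier_integrable smooth_measurable test_function_smooth
    by (fastforce simp: measurable_lborel2)+
  have gint: "integrable lborel ?g"
    by (rule integrable_of_real[OF integrable_gaussian])
  have gk: "integrable lborel (\<lambda>x. ?g ((1 / ?k k) *\<^sub>R x))" for k
  proof -
    have "integrable (distr lborel borel (\<lambda>x::'a. 0 + (1 / ?k k) *\<^sub>R x)) ?g"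
      by (subst lborel_distr_affine) (use gint in \<open>auto simp: integrable_density\<close>)
    then show ?thesis by (subst (asm) integrable_distr_eq) auto
  qed
  have hint: "integrable lborel (h k)" for k
    unfolding h_def by (rule integrable_mult_bounded[OF gk, of _ 1]) auto
  have hn: "norm (h k x) \<le> 1" for k x
    by (simp add: h_def norm_mult)
  have inv_h: "inv_fourier (h k) \<xi> = of_real (?c * ?k k ^ ?n) * ?g (?k k *\<^sub>R (\<xi> - y))" for k \<xi>
  proof -
    have "inv_fourier (h k) \<xi> = of_real ((2 * pi) powr (- real ?n)) *
        (\<integral>x. (\<lambda>z. iexp ((?k k *\<^sub>R (\<xi> - y)) \<bullet> z) * ?g z) (0 + (1 / ?k k) *\<^sub>R x) \<partial>lborel)"
    proof -
      have "iexp (\<xi> \<bullet> x) * h k x = iexp ((?k k *\<^sub>R (\<xi> - y)) \<bullet> (0 + (1 / ?k k) *\<^sub>R x)) *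
          ?g (0 + (1 / ?k k) *\<^sub>R x)" for x
      proof -
        have "(?k k *\<^sub>R (\<xi> - y)) \<bullet> (0 + (1 / ?k k) *\<^sub>R x) = \<xi> \<bullet> x - x \<bullet> y"
          by (simp add: inner_diff_left inner_diff_right inner_commute del: of_nat_Suc)
        then have "iexp ((?k k *\<^sub>R (\<xi> - y)) \<bullet> (0 + (1 / ?k k) *\<^sub>R x)) =
            iexp (\<xi> \<bullet> x) * exp (- \<i> * of_real (x \<bullet> y))"
          by (simp add: exp_add[symmetric] algebra_simps del: of_nat_Suc)
        then show ?thesis by (simp add: h_def)
      qed
      then show ?thesis unfolding inv_fourier_def by (simp only:)
    qed
    also have "\<dots> = of_real ((2 * pi) powr (- real ?n)) * (?k k ^ ?n *\<^sub>R
        of_real ((2 * pi) powr (real ?n / 2) * exp (- (norm (?k k *\<^sub>R (\<xi> - y)))\<^sup>2 / 2)))"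
      by (subst integral_lborel_affine) (auto simp only: fourier_gaussian, auto simp: power_one_over)
    also have "\<dots> = of_real ((2 * pi) powr (- real ?n) * (2 * pi) powr (real ?n / 2) * ?k k ^ ?n) * ?g (?k k *\<^sub>R (\<xi> - y))"
      by (simp add: scaleR_conv_of_real)
    also have "(2 * pi) powr (- real ?n) * (2 * pi) powr (real ?n / 2) = ?c"
      by (simp flip: powr_add)
    finally show ?thesis .
  qed
  have E: "(\<integral>x. h k x * inv_fourier f x \<partial>lborel) = of_real ?c * (\<integral>z. f (y + (1 / ?k k) *\<^sub>R z) * ?g z \<partial>lborel)" for k
  proof -
    have "(\<integral>x. h k x * inv_fourier f x \<partial>lborel) = (\<integral>x. inv_fourier (h k) x * f x \<partial>lborel)"
      by (rule integral_mult_inv_fourier[OF hint test_function_integrable[OF f]])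
    also have "\<dots> = of_real (?c * ?k k ^ ?n) * (\<integral>\<xi>. ?g (?k k *\<^sub>R (\<xi> - y)) * f \<xi> \<partial>lborel)"
      by (simp add: inv_h mult.assoc)
    also have "(\<integral>\<xi>. ?g (?k k *\<^sub>R (\<xi> - y)) * f \<xi> \<partial>lborel) =
        (1 / ?k k ^ ?n) *\<^sub>R (\<integral>z. f (y + (1 / ?k k) *\<^sub>R z) * ?g z \<partial>lborel)"
      using integral_lborel_affine[of "1 / ?k k" "\<lambda>\<xi>. ?g (?k k *\<^sub>R (\<xi> - y)) * f \<xi>" y]
      by (simp add: mult.commute power_one_over del: of_nat_Suc)
    finally show ?thesis
      by (simp add: scaleR_conv_of_real del: of_nat_Suc)
  qed
  have L1: "(\<lambda>k. \<integral>x. h k x * inv_fourier f x \<partial>lborel) \<longlonglongrightarrow> fourier (inv_fourier f) y"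
    unfolding fourier_def
  proof (rule integral_dominated_convergence)
    show "integrable lborel (\<lambda>x. norm (inv_fourier f x))"
      using inv_fourier_integrable[OF f] by simp
    have "(\<lambda>k. 1 / ?k k) \<longlonglongrightarrow> 0"
      using LIMSEQ_inverse_real_of_nat by (simp add: inverse_eq_divide)
    then have "(\<lambda>k. h k x) \<longlonglongrightarrow> exp (- \<i> * of_real (x \<bullet> y)) * ?g (0 *\<^sub>R x)" for x
      unfolding h_def by (intro tendsto_intros) auto
    then show "AE x in lborel. (\<lambda>k. h k x * inv_fourier f x) \<longlonglongrightarrow> exp (- \<i> * of_real (x \<bullet> y)) * inv_fourier f x"
      by (intro AE_I2 tendsto_mult tendsto_const) simp
    show "AE x in lborel. norm (h k x * inv_fourier f x) \<le> norm (inv_fourier f x)" for k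
      using hn by (simp add: norm_mult mult_left_le_one_le)
    show "(\<lambda>x. h k x * inv_fourier f x) \<in> borel_measurable lborel" for k
      unfolding h_def by measurable
  qed measurable
  have L2: "(\<lambda>k. of_real ?c * (\<integral>z. f (y + (1 / ?k k) *\<^sub>R z) * ?g z \<partial>lborel)) \<longlonglongrightarrow>
      of_real ?c * (\<integral>z. f y * ?g z \<partial>lborel)"
  proof (intro tendsto_mult tendsto_const, rule integral_dominated_convergence)
    show "integrable lborel (\<lambda>x. M * norm (?g x))"
      using integrable_norm[OF gint] by simp
    show "AE x in lborel. norm (f (y + (1 / ?k k) *\<^sub>R x) * ?g x) \<le> M * norm (?g x)" for k
      unfolding norm_mult by (intro AE_I2 mult_right_mono M) auto
    have "(\<lambda>k. 1 / ?k k) \<longlonglongrightarrow> 0"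
      using LIMSEQ_inverse_real_of_nat by (simp add: inverse_eq_divide)
    then have "(\<lambda>k. y + (1 / ?k k) *\<^sub>R x) \<longlonglongrightarrow> y + 0 *\<^sub>R x" for x
      by (intro tendsto_intros)
    then have "(\<lambda>k. f (y + (1 / ?k k) *\<^sub>R x)) \<longlonglongrightarrow> f (y + 0 *\<^sub>R x)" for x
      by (rule isCont_tendsto_compose[OF differentiable_imp_continuous_within[OF
            smooth_differentiable[OF test_function_smooth[OF f]]]])
    then have "(\<lambda>k. f (y + (1 / ?k k) *\<^sub>R x)) \<longlonglongrightarrow> f y" for x
      by (simp del: of_nat_Suc)
    then show "AE x in lborel. (\<lambda>k. f (y + (1 / ?k k) *\<^sub>R x) * ?g x) \<longlonglongrightarrow> f y * ?g x"
      by (intro AE_I2 tendsto_mult tendsto_const)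
  qed measurable
  have L3: "of_real ?c * (\<integral>z. f y * ?g z \<partial>lborel) = f y"
  proof -
    have "(\<integral>z. ?g z \<partial>lborel) = of_real ((2 * pi) powr (real ?n / 2))"
      using fourier_gaussian[of "0::'a"] by simp
    moreover have "?c * (2 * pi) powr (real ?n / 2) = 1"
      by (simp flip: powr_add)
    ultimately show ?thesis
      by (simp flip: of_real_mult add: mult.left_commute)
  qed
  show ?thesis
    using LIMSEQ_unique[OF L1[unfolded E] L2] unfolding L3 .
qed

section \<open>The representing function of a distribution is unique\<close>

lemma cutoff_bounded:
  assumes "cutoff \<Psi>"
  shows "\<exists>M. \<forall>t. \<bar>1 - \<Psi> t\<bar> \<le> M"
proof -
  have \<Psi>: "smooth \<Psi>" "\<And>t. t < 11/10 \<Longrightarrow> \<Psi> t = 1" "\<And>t. t > 13/10 \<Longrightarrow> \<Psi> t = 0"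
    using assms by (auto simp: cutoff_def)
  have "compact (\<Psi> ` {11/10..13/10})"
    by (intro compact_continuous_image smooth_continuous_on \<Psi>) auto
  then obtain M where "\<And>t. t \<in> {11/10..13/10} \<Longrightarrow> \<bar>\<Psi> t\<bar> \<le> M"
    using compact_imp_bounded bounded_iff by (metis imageI real_norm_def)
  then have "\<bar>1 - \<Psi> t\<bar> \<le> max 1 (1 + M)" for t
    using \<Psi>(2,3)[of t] by (cases "t \<in> {11/10..13/10}") (fastforce simp: not_le)+
  then show ?thesis by blast
qed

text \<open>The indicator of an open box is the bounded pointwise limit of test functions supported in the
  closed box: a product of one-dimensional transitions \<open>s k\<close>, which vanish on \<open>t \<le> 0\<close> and equal \<open>1\<close> for
  \<open>t\<close> larger than a multiple of \<open>1/k\<close>. They are made from \<open>\<Psi>\<close>, so that no other bump function has to be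
  constructed.\<close>
lemma integral_box_eq_0:
  fixes h :: "'a::euclidean_space \<Rightarrow> complex"
  assumes \<Psi>: "cutoff \<Psi>" and [measurable]: "h \<in> borel_measurable borel"
    and int: "set_integrable lborel (cbox a c) h"
    and test: "\<And>\<phi>. test_function \<phi> \<Longrightarrow> (\<integral>x. h x * \<phi> x \<partial>lborel) = 0"
  shows "(\<integral>x. indicator (box a c) x *\<^sub>R h x \<partial>lborel) = 0"
proof -
  obtain M where M: "\<And>t. \<bar>1 - \<Psi> t\<bar> \<le> M"
    using cutoff_bounded[OF \<Psi>] by blast
  have M0: "0 \<le> M" using M[of 0] by (meson abs_ge_zero order_trans)
  have sm: "smooth (\<lambda>t. 1 - \<Psi> t)"
    using \<Psi> by (auto simp: cutoff_def intro!: smooth_diff smooth_const)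
  define s where "s k t = 1 - \<Psi> (1 + real (Suc k) * t)" for k t
  have sM: "norm (complex_of_real (s k t)) \<le> M" for k t
    by (simp only: norm_of_real s_def M)
  have s0: "s k t = 0" if "t \<le> 0" for k t
  proof -
    have "1 + real (Suc k) * t < 11/10"
      using mult_nonneg_nonpos[of "real (Suc k)" t] that by linarith
    then show ?thesis using \<Psi> by (simp add: s_def cutoff_def)
  qed
  have s1: "(\<lambda>k. s k t) \<longlonglongrightarrow> 1" if "t > 0" for t
  proof (rule tendsto_eventually)
    obtain N where N: "1 < real N * t"
      using reals_Archimedean3[OF \<open>t > 0\<close>] by blast
    have "s k t = 1" if "k \<ge> N" for k
    proof -
      have "real N * t \<le> real (Suc k) * t"
        using that \<open>t > 0\<close> by (intro mult_right_mono) auto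
      then show ?thesis using N \<Psi> by (simp add: s_def cutoff_def)
    qed
    then show "\<forall>\<^sub>F k in sequentially. s k t = 1"
      by (auto simp: eventually_sequentially)
  qed
  define \<phi> where "\<phi> k x = (\<Prod>b\<in>Basis. complex_of_real (s k ((x - a) \<bullet> b)) * complex_of_real (s k ((c - x) \<bullet> b)))" for k x
  have supp: "x \<in> cbox a c" if "\<phi> k x \<noteq> 0" for k x
  proof -
    have "\<not> (x - a) \<bullet> b \<le> 0 \<and> \<not> (c - x) \<bullet> b \<le> 0" if "b \<in> Basis" for b
      using \<open>\<phi> k x \<noteq> 0\<close> that s0 by (auto simp: \<phi>_def)
    then show ?thesis
      unfolding mem_box inner_diff_left by (meson diff_le_0_iff_le less_imp_le not_le)
  qed
  have "test_function (\<phi> k)" for k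
    unfolding test_function_iff
  proof
    have "smooth (\<lambda>x. complex_of_real (s k ((x - a) \<bullet> b)))" for b
      using smooth_ridge[OF sm, of "real (Suc k) *\<^sub>R b" "1 - real (Suc k) * (a \<bullet> b)"]
      by (simp add: s_def inner_diff_left inner_commute algebra_simps)
    moreover have "smooth (\<lambda>x. complex_of_real (s k ((c - x) \<bullet> b)))" for b
      using smooth_ridge[OF sm, of "- real (Suc k) *\<^sub>R b" "1 + real (Suc k) * (c \<bullet> b)"]
      by (simp add: s_def inner_diff_left inner_commute algebra_simps)
    ultimately show "smooth (\<phi> k)"
      unfolding \<phi>_def by (intro smooth_prod smooth_mult)
    obtain R where "\<And>x. x \<in> cbox a c \<Longrightarrow> norm x \<le> R"
      using bounded_cbox bounded_iff by metis
    then show "\<exists>R. \<forall>x. R < norm x \<longrightarrow> \<phi> k x = 0"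
      using supp by (meson not_le)
  qed
  then have z: "(\<integral>x. h x * \<phi> k x \<partial>lborel) = 0" and m: "\<phi> k \<in> borel_measurable borel" for k
    using test smooth_measurable test_function_smooth by blast+
  note [measurable] = m
  have "(\<lambda>k. \<integral>x. h x * \<phi> k x \<partial>lborel) \<longlonglongrightarrow> (\<integral>x. indicator (box a c) x *\<^sub>R h x \<partial>lborel)"
  proof (rule integral_dominated_convergence)
    let ?w = "\<lambda>x. (M * M) ^ DIM('a) * norm (indicator (cbox a c) x *\<^sub>R h x)"
    show "integrable lborel ?w"
      using integrable_norm[OF int[unfolded set_integrable_def]] by (rule integrable_mult_right)
    have bound: "norm (\<phi> k x) \<le> (M * M) ^ DIM('a)" for k x
    proof -
      have "norm (\<phi> k x) \<le> (\<Prod>b\<in>(Basis::'a set). M * M)"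
        unfolding \<phi>_def prod_norm[symmetric]
        using M0 by (intro prod_mono) (auto simp: norm_mult intro!: mult_mono sM simp del: norm_of_real)
      then show ?thesis by simp
    qed
    show "AE x in lborel. norm (h x * \<phi> k x) \<le> ?w x" for k
    proof (intro AE_I2)
      fix x
      show "norm (h x * \<phi> k x) \<le> ?w x"
        using supp[of k x] bound[of k x]
        by (cases "\<phi> k x = 0") (auto simp: norm_mult mult.commute M0 intro!: mult_left_mono)
    qed
    show "AE x in lborel. (\<lambda>k. h x * \<phi> k x) \<longlonglongrightarrow> indicator (box a c) x *\<^sub>R h x"
    proof (intro AE_I2)
      fix x
      show "(\<lambda>k. h x * \<phi> k x) \<longlonglongrightarrow> indicator (box a c) x *\<^sub>R h x"
      proof (cases "x \<in> box a c")
        case True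
        have "(\<lambda>k. \<phi> k x) \<longlonglongrightarrow> (\<Prod>b\<in>(Basis::'a set). complex_of_real 1 * complex_of_real 1)"
          unfolding \<phi>_def using True
          by (intro tendsto_prod tendsto_mult tendsto_of_real s1) (auto simp: mem_box inner_diff_left)
        then have "(\<lambda>k. h x * \<phi> k x) \<longlonglongrightarrow> h x * 1"
          by (intro tendsto_mult tendsto_const) simp
        with True show ?thesis by simp
      next
        case False
        then obtain b where b: "b \<in> Basis" "(x - a) \<bullet> b \<le> 0 \<or> (c - x) \<bullet> b \<le> 0"
          unfolding mem_box inner_diff_left by (meson diff_le_0_iff_le not_le)
        then have "\<phi> k x = 0" for k
          using s0 by (auto simp: \<phi>_def intro!: bexI[of _ b])
        with False show ?thesis by simp
      qed
    qed
  qed measurable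
  then show ?thesis
    unfolding z by (simp add: LIMSEQ_const_iff)
qed

text \<open>Boxes are stable under intersection and generate the Borel sets, so all integrals over Borel
  sets vanish by Dynkin's theorem.\<close>
lemma AE_eq_0_if_integral_box_eq_0:
  fixes H :: "'a::euclidean_space \<Rightarrow> complex"
  assumes H: "integrable lborel H" and H0: "integral\<^sup>L lborel H = 0"
    and box: "\<And>a c. (\<integral>x. indicator (box a c) x *\<^sub>R H x \<partial>lborel) = 0"
  shows "AE x in lborel. H x = 0"
proof -
  have all: "(LINT x:A|lborel. H x) = 0" if "A \<in> sets borel" for A
  proof -
    let ?G = "range (\<lambda>(a, b). box a b :: 'a set)"
    have "Int_stable ?G" by (auto simp: Int_stable_def box_Int_box)
    moreover have "?G \<subseteq> Pow UNIV" by auto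
    moreover have "A \<in> sigma_sets UNIV ?G"
      using that unfolding borel_eq_box by simp
    ultimately show ?thesis
    proof (induction rule: sigma_sets_induct_disjoint)
      case (basic A)
      then show ?case using box by (auto simp: set_lebesgue_integral_def)
    next
      case empty
      then show ?case by (simp add: set_lebesgue_integral_def)
    next
      case (compl A)
      then have [measurable]: "A \<in> sets borel"
        unfolding borel_eq_box by simp
      have "(LINT x:(UNIV - A)|lborel. H x) = integral\<^sup>L lborel H - (LINT x:A|lborel. H x)"
      proof -
        have "integrable lborel (\<lambda>x. indicator A x *\<^sub>R H x)"
          using H by (intro integrable_mult_indicator) auto
        then have "(\<integral>x. H x - indicator A x *\<^sub>R H x \<partial>lborel) = integral\<^sup>L lborel H - (LINT x:A|lborel. H x)"
          unfolding set_lebesgue_integral_def using H by (intro Bochner_Integration.integral_diff)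
        moreover have "indicator (UNIV - A) x *\<^sub>R H x = H x - indicator A x *\<^sub>R H x" for x
          by (auto simp: indicator_def)
        ultimately show ?thesis
          unfolding set_lebesgue_integral_def by simp
      qed
      with compl H0 show ?case by simp
    next
      case (union A)
      have A: "A i \<in> sets borel" for i
        using union(2) by (auto simp: borel_eq_box)
      then have "set_integrable lborel (\<Union>i. A i) H"
        unfolding set_integrable_def using H by (intro integrable_mult_indicator) auto
      then have "(LINT x:(\<Union>i. A i)|lborel. H x) = (\<Sum>i. (LINT x:(A i)|lborel. H x))"
        using union(1) A by (intro lebesgue_integral_countable_add) (auto simp: disjoint_family_on_def)
      with union show ?case by simp
    qed
  qed
  have "AE x in lborel. L (H x) = 0" if L: "bounded_linear L" for L :: "complex \<Rightarrow> real"
  proof (rule density_unique_real)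
    interpret bounded_linear L by fact
    show "integrable lborel (\<lambda>x. L (H x))"
      by (rule integrable_bounded_linear[OF L H])
    fix A :: "'a set" assume A: "A \<in> sets lborel"
    have "integrable lborel (\<lambda>x. indicator A x *\<^sub>R H x)"
      using H A by (intro integrable_mult_indicator)
    then have "(\<integral>x. L (indicator A x *\<^sub>R H x) \<partial>lborel) = L (LINT x:A|lborel. H x)"
      unfolding set_lebesgue_integral_def by (rule integral_bounded_linear[OF L])
    then show "(LINT x:A|lborel. L (H x)) = (LINT x:A|lborel. 0)"
      using all[of A] A by (simp add: set_lebesgue_integral_def scaleR zero)
  qed auto
  from this[OF bounded_linear_Re] this[OF bounded_linear_Im] show ?thesis
    by eventually_elim (simp add: complex_eq_iff)
qed

lemma represented_by_unique:
  fixes u :: "'a::euclidean_space distr"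
  assumes \<Psi>: "cutoff \<Psi>" and f: "represented_by u f" and g: "represented_by u g"
  shows "AE x in lborel. f x = g x"
proof -
  have [measurable]: "f \<in> borel_measurable borel" "g \<in> borel_measurable borel"
    using f g by (auto simp: represented_by_def)
  define h where "h x = f x - g x" for x
  have hm[measurable]: "h \<in> borel_measurable borel" unfolding h_def by measurable
  have int: "set_integrable lborel (cbox a c) h" for a c
    using f g unfolding represented_by_def h_def by (intro set_integral_diff) auto
  have test: "(\<integral>x. h x * \<phi> x \<partial>lborel) = 0" if \<phi>: "test_function \<phi>" for \<phi>
  proof -
    have i: "integrable lborel (\<lambda>x. k x * \<phi> x)" if k: "represented_by u k" for k
    proof -
      obtain R where R: "\<And>x. R < norm x \<Longrightarrow> \<phi> x = 0"
        using \<phi> unfolding test_function_iff by blast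
      obtain M where M: "\<And>x. norm (\<phi> x) \<le> M"
        using test_function_bounded[OF \<phi>] by blast
      have "integrable lborel (\<lambda>x. indicator (cball 0 R) x *\<^sub>R k x)"
        using k by (auto simp: represented_by_def set_integrable_def)
      then have "integrable lborel (\<lambda>x. \<phi> x * (indicator (cball 0 R) x *\<^sub>R k x))"
        by (rule integrable_mult_bounded[OF _ _ M])
          (use \<phi> smooth_measurable test_function_smooth in auto)
      also have "(\<lambda>x. \<phi> x * (indicator (cball 0 R) x *\<^sub>R k x)) = (\<lambda>x. k x * \<phi> x)"
        using R by (auto simp: fun_eq_iff indicator_def not_le)
      finally show ?thesis .
    qed
    have "(\<integral>x. h x * \<phi> x \<partial>lborel) = (\<integral>x. f x * \<phi> x \<partial>lborel) - (\<integral>x. g x * \<phi> x \<partial>lborel)"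
      unfolding h_def using i[OF f] i[OF g] by (simp add: left_diff_distrib)
    also have "\<dots> = 0"
      using f g \<phi> by (simp add: represented_by_def distr_of_def)
    finally show ?thesis .
  qed
  have "AE x in lborel. x \<in> box (- real n *\<^sub>R One) (real n *\<^sub>R One) \<longrightarrow> h x = 0" for n
  proof -
    let ?B = "box (- real n *\<^sub>R One) (real n *\<^sub>R One) :: 'a set"
    let ?H = "\<lambda>x. indicator ?B x *\<^sub>R h x"
    note box = integral_box_eq_0[OF \<Psi> hm int test]
    have "AE x in lborel. ?H x = 0"
    proof (rule AE_eq_0_if_integral_box_eq_0)
      show "integrable lborel ?H"
        unfolding set_integrable_def[symmetric]
        by (rule set_integrable_subset[OF int _ box_subset_cbox]) simp
      show "integral\<^sup>L lborel ?H = 0"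
        by (rule box)
      fix a c :: 'a
      obtain a' c' :: 'a where "box a c \<inter> ?B = box a' c'"
        by (simp add: box_Int_box)
      then have eq: "indicator (box a c) x *\<^sub>R ?H x = indicator (box a' c') x *\<^sub>R h x" for x
        by (auto simp: indicator_def)
      show "(\<integral>x. indicator (box a c) x *\<^sub>R ?H x \<partial>lborel) = 0"
        unfolding eq by (rule box)
    qed
    then show ?thesis by eventually_elim (auto simp: indicator_def)
  qed
  then have "AE x in lborel. \<forall>n. x \<in> box (- real n *\<^sub>R One) (real n *\<^sub>R One) \<longrightarrow> h x = 0"
    unfolding AE_all_countable by blast
  then show ?thesis
  proof eventually_elim
    case (elim x)
    have "x \<in> (\<Union>n::nat. box (- (real n *\<^sub>R One)) (real n *\<^sub>R One))"
      unfolding UN_box_eq_UNIV by simp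
    then obtain n where "x \<in> box (- real n *\<^sub>R One) (real n *\<^sub>R One)"
      by auto
    with elim show ?case by (auto simp: h_def)
  qed
qed

lemma Lp_norm_cong_AE:
  assumes [measurable]: "f \<in> borel_measurable borel" "g \<in> borel_measurable borel"
    and "AE x in lborel. f x = g x"
  shows "Lp_norm p f = Lp_norm p g"
proof -
  have "esssup lborel (\<lambda>x. ennreal (norm (f x))) = esssup lborel (\<lambda>x. ennreal (norm (g x)))"
    by (rule esssup_AE_cong) (use assms(3) in \<open>auto elim: eventually_mono\<close>)
  moreover have "(\<integral>\<^sup>+x. ennreal_rpow (ennreal (norm (f x))) (enn2real p) \<partial>lborel) =
      (\<integral>\<^sup>+x. ennreal_rpow (ennreal (norm (g x))) (enn2real p) \<partial>lborel)"
    by (rule nn_integral_cong_AE) (use assms(3) in \<open>auto elim: eventually_mono\<close>)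
  ultimately show ?thesis
    by (simp add: Lp_norm_def)
qed

lemma distr_Lp_norm_eq:
  assumes \<Psi>: "cutoff \<Psi>" and g: "represented_by u g"
  shows "distr_Lp_norm p u = Lp_norm p g"
proof -
  have "Lp_norm p f = Lp_norm p g" if "represented_by u f" for f
    using represented_by_unique[OF \<Psi> that g] that g
    by (intro Lp_norm_cong_AE) (auto simp: represented_by_def)
  then have "Lp_norm p g \<le> distr_Lp_norm p u"
    unfolding distr_Lp_norm_def by (intro INF_greatest) simp
  moreover have "distr_Lp_norm p u \<le> Lp_norm p g"
    unfolding distr_Lp_norm_def by (rule INF_lower) (simp add: g)
  ultimately show ?thesis by (rule antisym[rotated])
qed

section \<open>Distributions given by band-limited functions\<close>

lemma schwartz_bounded:
  assumes "schwartz \<phi>"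
  shows "bdd_above (range (\<lambda>x. norm (\<phi> x)))"
  using assms unfolding schwartz_def
  by (metis (no_types, lifting) UNIV_I empty_set empty_subsetI image_cong mult_1 partials.simps(1) power_0)

lemma integrable_mult_schwartz:
  assumes "integrable lborel f" "schwartz \<phi>"
  shows "integrable lborel (\<lambda>x. f x * \<phi> x)"
proof -
  obtain C where C: "\<And>x. norm (\<phi> x) \<le> C"
    using schwartz_bounded[OF assms(2)] by (auto simp: bdd_above_def)
  have "\<phi> \<in> borel_measurable lborel"
    using assms(2) smooth_measurable by (auto simp: schwartz_def)
  then have "integrable lborel (\<lambda>x. \<phi> x * f x)"
    using C by (rule integrable_mult_bounded[OF assms(1)])
  then show ?thesis by (simp add: mult.commute)
qed

text \<open>An integrable density pairs with bounded functions, so already the seminorm of order \<open>0\<close> suffices.\<close>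
lemma tempered_distr_of:
  fixes f :: "'a::euclidean_space \<Rightarrow> complex"
  assumes f: "integrable lborel f"
  shows "tempered (distr_of f)"
  unfolding tempered_def
proof (intro conjI allI impI exI)
  fix \<phi> \<psi> :: "'a \<Rightarrow> complex" and a assume \<phi>: "schwartz \<phi>"
  note i = integrable_mult_schwartz[OF f]
  show "distr_of f (\<lambda>x. \<phi> x + \<psi> x) = distr_of f \<phi> + distr_of f \<psi>" if "schwartz \<psi>"
    using i[OF \<phi>] i[OF that] by (simp add: distr_of_def distrib_left)
  show "distr_of f (\<lambda>x. a * \<phi> x) = a * distr_of f \<phi>"
    by (simp add: distr_of_def mult.left_commute)
  have "norm (distr_of f \<phi>) \<le> (\<integral>x. norm (f x * \<phi> x) \<partial>lborel)"
    unfolding distr_of_def by (rule integral_norm_bound)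
  also have "\<dots> \<le> (\<integral>x. norm (f x) * (SUP x. norm (\<phi> x)) \<partial>lborel)"
  proof (rule integral_mono)
    fix x
    show "norm (f x * \<phi> x) \<le> norm (f x) * (SUP x. norm (\<phi> x))"
      unfolding norm_mult by (intro mult_left_mono cSUP_upper schwartz_bounded \<phi>) auto
  qed (use integrable_norm[OF i[OF \<phi>]] f in auto)
  also have "\<dots> = (\<integral>x. norm (f x) \<partial>lborel) * schwartz_seminorm 0 \<phi>"
  proof -
    have "{bs. set bs \<subseteq> Basis \<and> length bs \<le> 0} = {[] :: 'a list}" by auto
    then show ?thesis by (simp add: schwartz_seminorm_def)
  qed
  finally show "norm (distr_of f \<phi>) \<le> (\<integral>x. norm (f x) \<partial>lborel) * schwartz_seminorm 0 \<phi>" .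
qed

lemma represented_by_distr_of:
  assumes "integrable lborel f"
  shows "represented_by (distr_of f) f"
  using assms unfolding represented_by_def set_integrable_def
  by (auto intro!: integrable_mult_indicator borel_compact)

text \<open>Fourier inversion identifies the Fourier transform of this distribution with the function \<open>f\<close>.\<close>
lemma distr_supp_fourier_inv_fourier:
  fixes f :: "'a::euclidean_space \<Rightarrow> complex"
  assumes f: "test_function f" and supp: "\<And>\<xi>. \<rho> < norm \<xi> \<Longrightarrow> f \<xi> = 0"
  shows "distr_supp (distr_fourier (distr_of (inv_fourier f))) \<subseteq> {\<xi>. norm \<xi> \<le> \<rho>}"
proof
  fix \<xi> assume \<xi>: "\<xi> \<in> distr_supp (distr_fourier (distr_of (inv_fourier f)))"
  show "\<xi> \<in> {\<xi>. norm \<xi> \<le> \<rho>}"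
  proof (rule ccontr)
    assume "\<not> ?thesis"
    then have "\<xi> \<in> {\<xi>. \<rho> < norm \<xi>}" by simp
    moreover have "open {\<xi>::'a. \<rho> < norm \<xi>}"
      by (intro open_Collect_less continuous_intros)
    moreover have "distr_fourier (distr_of (inv_fourier f)) \<phi> = 0"
      if \<phi>: "test_function \<phi>" "closure {x. \<phi> x \<noteq> 0} \<subseteq> {\<xi>. \<rho> < norm \<xi>}" for \<phi>
    proof -
      have "distr_fourier (distr_of (inv_fourier f)) \<phi> = (\<integral>x. fourier (inv_fourier f) x * \<phi> x \<partial>lborel)"
        unfolding distr_fourier_def distr_of_def
        by (intro integral_mult_fourier inv_fourier_integrable test_function_integrable f \<phi>)
      moreover have "fourier (inv_fourier f) x * \<phi> x = 0" for x
        using \<phi>(2) supp[of x] closure_subset[of "{x. \<phi> x \<noteq> 0}"] by (auto simp: fourier_inv_fourier[OF f])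
      ultimately show ?thesis by simp
    qed
    ultimately show False
      using \<xi> unfolding distr_supp_def by blast
  qed
qed

text \<open>The frequency blocks of the Besov quasi-norm are of this form. Moving the two transforms in turn
  onto the other factor gives \<open>\<integral> \<F>(\<F>\<^sup>-\<^sup>1 f) m \<F>\<^sup>-\<^sup>1\<phi> = \<integral> \<F>\<^sup>-\<^sup>1(m f) \<phi>\<close>, by Fourier inversion for \<open>f\<close>.\<close>
lemma represented_by_multiplier:
  fixes f m :: "'a::euclidean_space \<Rightarrow> complex"
  assumes f: "test_function f" and m: "test_function m"
  shows "represented_by (distr_inv_fourier (distr_mult m (distr_fourier (distr_of (inv_fourier f)))))
    (inv_fourier (\<lambda>\<xi>. m \<xi> * f \<xi>))"
proof -
  have mf: "test_function (\<lambda>\<xi>. m \<xi> * f \<xi>)"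
    by (intro test_function_mult test_function_smooth m f)
  have "distr_inv_fourier (distr_mult m (distr_fourier (distr_of (inv_fourier f)))) \<phi> =
      distr_of (inv_fourier (\<lambda>\<xi>. m \<xi> * f \<xi>)) \<phi>" if \<phi>: "test_function \<phi>" for \<phi>
  proof -
    obtain M where M: "\<And>x. norm (m x) \<le> M"
      using test_function_bounded[OF m] by blast
    have i: "integrable lborel (\<lambda>\<xi>. m \<xi> * inv_fourier \<phi> \<xi>)"
      by (rule integrable_mult_bounded[OF inv_fourier_integrable[OF \<phi>] _ M])
        (use smooth_measurable[OF test_function_smooth[OF m]] in simp)
    have "distr_inv_fourier (distr_mult m (distr_fourier (distr_of (inv_fourier f)))) \<phi> =
        (\<integral>x. inv_fourier f x * fourier (\<lambda>\<xi>. m \<xi> * inv_fourier \<phi> \<xi>) x \<partial>lborel)"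
      by (simp add: distr_inv_fourier_def distr_mult_def distr_fourier_def distr_of_def)
    also have "\<dots> = (\<integral>x. fourier (inv_fourier f) x * (m x * inv_fourier \<phi> x) \<partial>lborel)"
      by (rule integral_mult_fourier[OF inv_fourier_integrable[OF f] i])
    also have "\<dots> = (\<integral>x. (m x * f x) * inv_fourier \<phi> x \<partial>lborel)"
      by (simp add: fourier_inv_fourier[OF f] mult_ac)
    also have "\<dots> = distr_of (inv_fourier (\<lambda>\<xi>. m \<xi> * f \<xi>)) \<phi>"
      unfolding distr_of_def
      by (rule integral_mult_inv_fourier[OF test_function_integrable[OF mf] test_function_integrable[OF \<phi>]])
    finally show ?thesis .
  qed
  moreover note represented_by_distr_of[OF inv_fourier_integrable[OF mf]]
  ultimately show ?thesis
    by (simp add: represented_by_def)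
qed

lemma inv_fourier_modulate_scale:
  fixes f :: "'a::euclidean_space \<Rightarrow> complex"
  assumes s: "0 < s" and [measurable]: "f \<in> borel_measurable borel"
  shows "inv_fourier (\<lambda>\<xi>. iexp ((- y) \<bullet> \<xi>) * f ((1 / s) *\<^sub>R \<xi>)) x =
    of_real (s ^ DIM('a)) * inv_fourier f (s *\<^sub>R (x - y))"
proof -
  let ?F = "\<lambda>\<xi>. iexp (x \<bullet> \<xi>) * (iexp ((- y) \<bullet> \<xi>) * f ((1 / s) *\<^sub>R \<xi>))"
  have "iexp ((s *\<^sub>R (x - y)) \<bullet> \<eta>) * f \<eta> = ?F (0 + s *\<^sub>R \<eta>)" for \<eta>
  proof -
    have "iexp ((s *\<^sub>R (x - y)) \<bullet> \<eta>) = iexp (x \<bullet> (s *\<^sub>R \<eta>)) * iexp ((- y) \<bullet> (s *\<^sub>R \<eta>))"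
      unfolding exp_add[symmetric] by (simp add: inner_diff_left algebra_simps)
    then show ?thesis using s by simp
  qed
  then have "(\<integral>\<eta>. iexp ((s *\<^sub>R (x - y)) \<bullet> \<eta>) * f \<eta> \<partial>lborel) = (\<integral>\<eta>. ?F (0 + s *\<^sub>R \<eta>) \<partial>lborel)"
    by (simp only:)
  also have "\<dots> = (1 / \<bar>s\<bar> ^ DIM('a)) *\<^sub>R (\<integral>\<xi>. ?F \<xi> \<partial>lborel)"
    by (rule integral_lborel_affine) (use s in auto)
  finally have "(\<integral>\<xi>. ?F \<xi> \<partial>lborel) = of_real (s ^ DIM('a)) * (\<integral>\<eta>. iexp ((s *\<^sub>R (x - y)) \<bullet> \<eta>) * f \<eta> \<partial>lborel)"
    using s by (simp add: scaleR_conv_of_real)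
  then show ?thesis
    by (simp only: inv_fourier_def mult.left_commute)
qed

section \<open>Quasi-norms\<close>

lemma ennreal_rpow_ennreal [simp]: "0 \<le> x \<Longrightarrow> ennreal_rpow (ennreal x) a = ennreal (x powr a)"
  by (simp add: ennreal_rpow_def)

lemma ennreal_rpow_mono:
  assumes "x \<le> y" "0 \<le> a"
  shows "ennreal_rpow x a \<le> ennreal_rpow y a"
proof (cases "y = \<infinity>")
  case False
  then obtain b where b: "y = ennreal b" "0 \<le> b" by (cases y) auto
  then obtain c where c: "x = ennreal c" "0 \<le> c"
    using assms(1) by (cases x) (auto simp: top_unique)
  with b assms show ?thesis by (simp add: powr_mono2)
qed (simp add: ennreal_rpow_def)

lemma enn2real_inverse_ennreal: "0 < P \<Longrightarrow> enn2real (1 / ennreal P) = 1 / P"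
  by (simp add: divide_ennreal flip: ennreal_1)

lemma Lp_norm_ennreal:
  assumes "0 < P"
  shows "Lp_norm (ennreal P) f = ennreal_rpow (\<integral>\<^sup>+x. ennreal (norm (f x) powr P) \<partial>lborel) (1 / P)"
  using assms by (simp add: Lp_norm_def)

lemma nn_integral_inv_fourier_powr_finite:
  fixes f :: "'a::euclidean_space \<Rightarrow> complex"
  assumes f: "test_function f" and P: "0 < P"
  shows "(\<integral>\<^sup>+x. ennreal (norm (inv_fourier f x) powr P) \<partial>lborel) < \<infinity>"
proof -
  have [measurable]: "inv_fourier f \<in> borel_measurable borel"
    using inv_fourier_integrable[OF f] by auto
  obtain k :: nat where k: "real (2 * DIM('a)) / P \<le> real k"
    using real_arch_simple by blast
  obtain C where C: "\<And>x. (1 + norm x) ^ k * norm (inv_fourier f x) \<le> C"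
    using inv_fourier_decay[OF f] by blast
  have "integrable lborel (\<lambda>x. norm (inv_fourier f x) powr P)"
  proof (rule integrable_decay)
    fix x :: 'a
    have "(1 + norm x) ^ (2 * DIM('a)) = (1 + norm x) powr real (2 * DIM('a))"
      by (rule powr_realpow[symmetric]) (simp add: add_pos_nonneg)
    also have "\<dots> \<le> (1 + norm x) powr (real k * P)"
      using k P by (intro powr_mono) (auto simp: field_simps)
    also have "\<dots> = ((1 + norm x) ^ k) powr P"
      by (simp add: powr_powr add_pos_nonneg flip: powr_realpow)
    finally have "(1 + norm x) ^ (2 * DIM('a)) * norm (norm (inv_fourier f x) powr P) \<le>
        ((1 + norm x) ^ k) powr P * norm (inv_fourier f x) powr P"
      by (simp add: mult_right_mono)
    also have "\<dots> = ((1 + norm x) ^ k * norm (inv_fourier f x)) powr P"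
      by (simp add: powr_mult)
    also have "\<dots> \<le> C powr P"
      using C P by (intro powr_mono2) auto
    finally show "(1 + norm x) ^ (2 * DIM('a)) * norm (norm (inv_fourier f x) powr P) \<le> C powr P" .
  qed measurable
  then show ?thesis
    by (simp add: integrable_iff_bounded)
qed

text \<open>The exponent \<open>n - n/p\<close> is the opposite of the one in \<open>series_bound\<close>. Keeping the constant \<open>K\<close> the
  same for all dilations and translations makes all terms of the extremal series equally large.\<close>
lemma Lp_norm_dilate_le:
  fixes f :: "'a::euclidean_space \<Rightarrow> complex"
  assumes f: "test_function f" and p: "0 < p"
  shows "\<exists>K\<ge>0. \<forall>s>0. \<forall>y. Lp_norm p (\<lambda>x. of_real (s ^ DIM('a)) * inv_fourier f (s *\<^sub>R (x - y)))
    \<le> ennreal (s powr (real DIM('a) - real DIM('a) * enn2real (1 / p)) * K)"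
proof -
  have [measurable]: "inv_fourier f \<in> borel_measurable borel"
    using inv_fourier_integrable[OF f] by auto
  show ?thesis
  proof (cases "p = \<infinity>")
    case True
    obtain C where C: "\<And>x. norm (inv_fourier f x) \<le> C"
      using inv_fourier_decay[OF f, of 0] by auto
    then have "0 \<le> C" using norm_ge_zero order_trans by blast
    moreover have "Lp_norm p (\<lambda>x. of_real (s ^ DIM('a)) * inv_fourier f (s *\<^sub>R (x - y)))
      \<le> ennreal (s powr (real DIM('a) - real DIM('a) * enn2real (1 / p)) * C)" if "s > 0" for s y
      using True that C
      by (auto simp: Lp_norm_def norm_mult norm_power powr_realpow intro!: esssup_I ennreal_leI mult_left_mono)
    ultimately show ?thesis by blast
  next
    case False
    then obtain P where P: "p = ennreal P" "0 < P"
      using p by (cases p) auto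
    let ?n = "real DIM('a)"
    obtain J where J: "(\<integral>\<^sup>+x. ennreal (norm (inv_fourier f x) powr P) \<partial>lborel) = ennreal J" "0 \<le> J"
      using nn_integral_inv_fourier_powr_finite[OF f P(2)]
      by (cases "\<integral>\<^sup>+x. ennreal (norm (inv_fourier f x) powr P) \<partial>lborel") auto
    have "Lp_norm p (\<lambda>x. of_real (s ^ DIM('a)) * inv_fourier f (s *\<^sub>R (x - y)))
      \<le> ennreal (s powr (?n - ?n * enn2real (1 / p)) * J powr (1 / P))" if s: "s > 0" for s y
    proof -
      have "(\<integral>\<^sup>+x. ennreal (norm (of_real (s ^ DIM('a)) * inv_fourier f (s *\<^sub>R (x - y))) powr P) \<partial>lborel) =
          (\<integral>\<^sup>+x. ennreal (s powr (?n * P)) * ennreal (norm (inv_fourier f (- (s *\<^sub>R y) + s *\<^sub>R x)) powr P) \<partial>lborel)"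
        using s by (intro nn_integral_cong)
          (simp add: norm_mult norm_power powr_mult powr_powr scaleR_diff_right flip: powr_realpow ennreal_mult)
      also have "\<dots> = ennreal (s powr (?n * P)) * (\<integral>\<^sup>+x. ennreal (norm (inv_fourier f (- (s *\<^sub>R y) + s *\<^sub>R x)) powr P) \<partial>lborel)"
        by (rule nn_integral_cmult) measurable
      also have "(\<integral>\<^sup>+x. ennreal (norm (inv_fourier f (- (s *\<^sub>R y) + s *\<^sub>R x)) powr P) \<partial>lborel) =
          ennreal (1 / \<bar>s\<bar> ^ DIM('a)) * ennreal J"
        using s J nn_integral_lborel_affine[of s "\<lambda>x. ennreal (norm (inv_fourier f x) powr P)" "- (s *\<^sub>R y)"]
        by simp
      also have "ennreal (s powr (?n * P)) * (ennreal (1 / \<bar>s\<bar> ^ DIM('a)) * ennreal J) =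
          ennreal (s powr (?n * P - ?n) * J)"
        using s J by (simp add: powr_diff powr_realpow flip: ennreal_mult)
      finally have "Lp_norm p (\<lambda>x. of_real (s ^ DIM('a)) * inv_fourier f (s *\<^sub>R (x - y))) =
          ennreal ((s powr (?n * P - ?n) * J) powr (1 / P))"
        using J P by (simp add: Lp_norm_ennreal)
      also have "(s powr (?n * P - ?n) * J) powr (1 / P) = s powr (?n - ?n * enn2real (1 / p)) * J powr (1 / P)"
        using P J by (simp add: powr_mult powr_powr enn2real_inverse_ennreal diff_divide_distrib)
      finally show ?thesis by simp
    qed
    then show ?thesis using J by (intro exI[of _ "J powr (1 / P)"]) auto
  qed
qed

text \<open>The lower bound is the \<open>L\<^sub>R\<close> quasi-norm of the function that is \<open>\<delta>\<close> on the disjoint balls and \<open>0\<close>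
  elsewhere.\<close>
lemma Lp_norm_ge_separated:
  fixes g :: "'a::euclidean_space \<Rightarrow> complex"
  assumes R: "0 < R" and [measurable]: "g \<in> borel_measurable borel" and I: "finite I"
    and \<rho>: "0 \<le> \<rho>" and \<delta>: "0 \<le> \<delta>"
    and disj: "disjoint_family_on (\<lambda>i. ball (z i) \<rho>) I"
    and ge: "\<And>i x. i \<in> I \<Longrightarrow> x \<in> ball (z i) \<rho> \<Longrightarrow> \<delta> \<le> norm (g x)"
  shows "ennreal (real (card I) powr (1 / R) * (\<delta> powr R * (unit_ball_vol (real DIM('a)) * \<rho> ^ DIM('a))) powr (1 / R))
    \<le> Lp_norm (ennreal R) g"
proof -
  let ?v = "unit_ball_vol (real DIM('a)) * \<rho> ^ DIM('a)"
  let ?U = "\<Union>i\<in>I. ball (z i) \<rho>"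
  have v: "0 \<le> ?v" using \<rho> by (simp add: less_imp_le)
  have [measurable]: "?U \<in> sets borel" using I by (intro borel_open open_UN) auto
  have "emeasure lborel ?U = (\<Sum>i\<in>I. emeasure lborel (ball (z i) \<rho>))"
    using disj I by (intro sum_emeasure[symmetric]) auto
  also have "\<dots> = ennreal (real (card I) * ?v)"
    using \<rho> v by (simp add: emeasure_ball ennreal_mult ennreal_of_nat_eq_real_of_nat)
  finally have U: "emeasure lborel ?U = ennreal (real (card I) * ?v)" .
  have "ennreal (\<delta> powr R) * emeasure lborel ?U = (\<integral>\<^sup>+x. ennreal (\<delta> powr R) * indicator ?U x \<partial>lborel)"
    by (simp add: nn_integral_cmult_indicator)
  also have "\<dots> \<le> (\<integral>\<^sup>+x. ennreal (norm (g x) powr R) \<partial>lborel)"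
  proof (rule nn_integral_mono)
    fix x
    show "ennreal (\<delta> powr R) * indicator ?U x \<le> ennreal (norm (g x) powr R)"
    proof (cases "x \<in> ?U")
      case True
      then have "\<delta> \<le> norm (g x)" using ge by blast
      with True show ?thesis using R \<delta> by (simp add: powr_mono2)
    qed simp
  qed
  finally have "ennreal (real (card I) * (\<delta> powr R * ?v)) \<le> (\<integral>\<^sup>+x. ennreal (norm (g x) powr R) \<partial>lborel)"
    unfolding U using v by (simp add: mult_ac flip: ennreal_mult)
  then have "ennreal_rpow (ennreal (real (card I) * (\<delta> powr R * ?v))) (1 / R) \<le> Lp_norm (ennreal R) g"
    unfolding Lp_norm_ennreal[OF R] using R by (intro ennreal_rpow_mono) auto
  then show ?thesis
    using v by (simp add: powr_mult)
qed

section \<open>Sums of widely separated translates\<close>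

text \<open>On a small ball about \<open>z\<close>, \<open>\<bar>G\<bar>\<close> exceeds \<open>2/3\<close> of \<open>\<bar>G z\<bar>\<close>. Since \<open>G\<close> decays, the \<open>N - 1\<close> other translates
  together contribute at most \<open>1/3\<close> of \<open>\<bar>G z\<bar>\<close> there, once the distance \<open>L\<close> between neighbours is large
  compared with \<open>N\<close>. Only the positions \<open>y\<close> depend on \<open>N\<close>; the radius \<open>\<rho>\<close> and the bound \<open>\<delta>\<close> do not.\<close>
lemma separated_translates:
  fixes G :: "'a::euclidean_space \<Rightarrow> complex"
  assumes cont: "isCont G z" and nz: "G z \<noteq> 0" and decay: "\<And>x. (1 + norm x) * norm (G x) \<le> C"
  shows "\<exists>\<rho>>0. \<exists>\<delta>>0. \<forall>N::nat. \<exists>y. disjoint_family_on (\<lambda>i. ball (y i + z) \<rho>) {1..N} \<and>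
    (\<forall>i\<in>{1..N}. \<forall>x\<in>ball (y i + z) \<rho>. \<delta> \<le> norm (\<Sum>j\<in>{1..N}. G (x - y j)))"
proof -
  define \<delta> where "\<delta> = norm (G z) / 3"
  have \<delta>: "0 < \<delta>" using nz by (simp add: \<delta>_def)
  obtain \<rho>0 where \<rho>0: "\<rho>0 > 0" "\<And>x. dist x z < \<rho>0 \<Longrightarrow> dist (G x) (G z) < \<delta>"
    using cont \<delta> unfolding continuous_at_eps_delta by blast
  define \<rho> where "\<rho> = min \<rho>0 1"
  have \<rho>: "0 < \<rho>" "\<rho> \<le> 1" "\<rho> \<le> \<rho>0" using \<rho>0 by (auto simp: \<rho>_def)
  have "0 \<le> (1 + norm (0::'a)) * norm (G 0)" by simp
  then have C: "0 \<le> C" using decay[of 0] by (rule order_trans)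
  obtain e :: 'a where e: "norm e = 1"
    using norm_Basis nonempty_Basis by (metis ex_in_conv)
  have "\<exists>y. disjoint_family_on (\<lambda>i. ball (y i + z) \<rho>) {1..N} \<and>
    (\<forall>i\<in>{1..N}. \<forall>x\<in>ball (y i + z) \<rho>. \<delta> \<le> norm (\<Sum>j\<in>{1..N}. G (x - y j)))" for N :: nat
  proof -
    \<comment> \<open>The middle term makes the tails small; the \<open>3\<close> exceeds the diameter \<open>2 \<rho> \<le> 2\<close> of the balls.\<close>
    define L where "L = norm z + real N * C / \<delta> + 3"
    have L: "3 \<le> L" "real N * C \<le> \<delta> * (L - norm z)" "0 < L - norm z"
      using C \<delta> by (auto simp: L_def field_simps add_pos_nonneg intro!: add_nonneg_pos)
    define y where "y i = (real i * L) *\<^sub>R e" for i :: nat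
    have sep: "L \<le> norm (y i - y j)" if "i \<noteq> j" for i j
    proof -
      have "1 \<le> \<bar>real i - real j\<bar>" using that by linarith
      then have "1 * L \<le> \<bar>real i - real j\<bar> * L"
        using L by (intro mult_right_mono) auto
      also have "\<dots> = norm (y i - y j)"
        using L e by (simp add: y_def abs_mult flip: scaleR_diff_left left_diff_distrib)
      finally show ?thesis by simp
    qed
    have near: "norm (x - y i - z) < \<rho>" if "x \<in> ball (y i + z) \<rho>" for x i
      using that by (simp add: dist_norm norm_minus_commute diff_diff_eq)
    have "disjoint_family_on (\<lambda>i. ball (y i + z) \<rho>) {1..N}"
      unfolding disjoint_family_on_def
    proof (intro ballI impI equals0I)
      fix i j x assume "i \<noteq> j" "x \<in> ball (y i + z) \<rho> \<inter> ball (y j + z) \<rho>"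
      then have "norm (x - y i - z) < \<rho>" "norm (x - y j - z) < \<rho>" "L \<le> norm (y i - y j)"
        using near sep by auto
      moreover have "norm (y i - y j) \<le> norm (x - y j - z) + norm (x - y i - z)"
        using norm_triangle_ineq4[of "x - y j - z" "x - y i - z"] by simp
      ultimately show False using \<rho> L by linarith
    qed
    moreover have "\<delta> \<le> norm (\<Sum>j\<in>{1..N}. G (x - y j))" if i: "i \<in> {1..N}" and x: "x \<in> ball (y i + z) \<rho>" for i x
    proof -
      have "dist (G (x - y i)) (G z) < \<delta>"
        using near[OF x] \<rho> by (intro \<rho>0) (simp add: dist_norm)
      then have main: "2 * \<delta> \<le> norm (G (x - y i))"
        using norm_triangle_ineq3[of "G z" "G (x - y i)"] by (simp add: \<delta>_def dist_norm norm_minus_commute)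
      have small: "norm (G (x - y j)) \<le> \<delta> / real N" if "j \<noteq> i" for j
      proof -
        have "norm (y i - y j) \<le> norm (x - y j) + norm (x - y i - z) + norm z"
          using norm_triangle_ineq4[of "x - y j" "x - y i"] norm_triangle_ineq[of "x - y i - z" z] by simp
        then have "L - norm z \<le> 1 + norm (x - y j)"
          using sep[of i j] that near[OF x] \<rho> by auto
        then have "(L - norm z) * norm (G (x - y j)) \<le> C"
          using decay[of "x - y j"] by (meson mult_right_mono norm_ge_zero order_trans)
        then have "real N * ((L - norm z) * norm (G (x - y j))) \<le> real N * C"
          by (rule mult_left_mono) simp
        then have "(L - norm z) * (real N * norm (G (x - y j))) \<le> (L - norm z) * \<delta>"
          using L(2) by (simp add: mult_ac)
        then have "real N * norm (G (x - y j)) \<le> \<delta>"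
          using L(3) by simp
        then show ?thesis using i by (simp add: field_simps)
      qed
      have "norm (\<Sum>j\<in>{1..N} - {i}. G (x - y j)) \<le> (\<Sum>j\<in>{1..N} - {i}. \<delta> / real N)"
        by (rule sum_norm_le) (use small in auto)
      also have "\<dots> \<le> (\<Sum>j\<in>{1..N}. \<delta> / real N)"
        using \<delta> by (intro sum_mono2) auto
      also have "\<dots> = \<delta>" using i by simp
      finally have rest: "norm (\<Sum>j\<in>{1..N} - {i}. G (x - y j)) \<le> \<delta>" .
      have "(\<Sum>j\<in>{1..N}. G (x - y j)) = G (x - y i) + (\<Sum>j\<in>{1..N} - {i}. G (x - y j))"
        using i by (simp add: sum.remove)
      then have "norm (G (x - y i)) - norm (\<Sum>j\<in>{1..N} - {i}. G (x - y j)) \<le> norm (\<Sum>j\<in>{1..N}. G (x - y j))"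
        using norm_diff_ineq by metis
      then show ?thesis using main rest by linarith
    qed
    ultimately show ?thesis by blast
  qed
  then show ?thesis using \<rho> \<delta> by blast
qed

section \<open>The extremal series\<close>

definition low_pass :: "(real \<Rightarrow> real) \<Rightarrow> 'a::euclidean_space \<Rightarrow> complex" where
  "low_pass \<Psi> \<xi> = of_real (LP_Phi \<Psi> 0 \<xi>)"

lemma
  assumes \<Psi>: "cutoff \<Psi>"
  shows test_function_low_pass: "test_function (low_pass \<Psi> :: 'a::euclidean_space \<Rightarrow> complex)"
    and low_pass_eq_1: "norm \<xi> < 11/10 \<Longrightarrow> low_pass \<Psi> (\<xi>::'a) = 1"
    and low_pass_eq_0: "13/10 < norm \<xi> \<Longrightarrow> low_pass \<Psi> (\<xi>::'a) = 0"
proof -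
  have eq: "low_pass \<Psi> \<xi> = of_real (\<Psi> (norm \<xi>))" for \<xi> :: 'a
    by (simp add: low_pass_def LP_Phi_def LP_Psi_def)
  show 1: "norm \<xi> < 11/10 \<Longrightarrow> low_pass \<Psi> (\<xi>::'a) = 1" and 0: "13/10 < norm \<xi> \<Longrightarrow> low_pass \<Psi> (\<xi>::'a) = 0" for \<xi>
    using \<Psi> by (auto simp: eq cutoff_def)
  have "smooth (\<lambda>t. 1 - \<Psi> t)"
    using \<Psi> by (auto simp: cutoff_def intro!: smooth_diff smooth_const)
  then have "smooth (\<lambda>\<xi>::'a. complex_of_real (1 - \<Psi> (norm \<xi>)))"
    by (rule smooth_radial[of _ "11/10"]) (use \<Psi> in \<open>auto simp: cutoff_def\<close>)
  then have "smooth (\<lambda>\<xi>::'a. 1 - complex_of_real (1 - \<Psi> (norm \<xi>)))"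
    by (rule smooth_diff[OF smooth_const])
  then have "smooth (low_pass \<Psi> :: 'a \<Rightarrow> complex)"
    by (simp add: eq[abs_def])
  with 0 show "test_function (low_pass \<Psi> :: 'a \<Rightarrow> complex)"
    unfolding test_function_iff by blast
qed

lemma inv_fourier_sum:
  assumes "\<And>i. i \<in> I \<Longrightarrow> integrable lborel (f i)"
  shows "inv_fourier (\<lambda>\<xi>. \<Sum>i\<in>I. f i \<xi>) x = (\<Sum>i\<in>I. inv_fourier (f i) x)"
  unfolding inv_fourier_def sum_distrib_left[symmetric]
  using assms by (subst Bochner_Integration.integral_sum[symmetric])
    (auto intro: integrable_iexp_mult simp: sum_distrib_left)

lemma lq_norm_le_card:
  assumes q: "0 < q" and J: "finite J" "J \<noteq> {}" and T: "0 \<le> T"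
    and le: "\<And>j. j \<in> J \<Longrightarrow> a j \<le> ennreal T" and 0: "\<And>j. j \<notin> J \<Longrightarrow> a j = 0"
  shows "lq_norm q a \<le> ennreal (T * real (card J) powr enn2real (1 / q))"
proof (cases "q = \<infinity>")
  case True
  have "(SUP j. a j) \<le> ennreal T"
    using le 0 by (intro SUP_least) (metis zero_le)
  moreover have "real (card J) powr 0 = 1" using J by simp
  ultimately show ?thesis using True by (simp add: lq_norm_def)
next
  case False
  then obtain Q where Q: "q = ennreal Q" "0 < Q"
    using q by (cases q) auto
  have "ennreal_rpow 0 Q = 0"
    using ennreal_rpow_ennreal[of 0 Q] by simp
  then have "(\<Sum>j. ennreal_rpow (a j) Q) = (\<Sum>j\<in>J. ennreal_rpow (a j) Q)"
    using J 0 by (intro suminf_finite) auto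
  also have "\<dots> \<le> (\<Sum>j\<in>J. ennreal (T powr Q))"
    using le T Q by (intro sum_mono) (metis ennreal_rpow_ennreal ennreal_rpow_mono less_imp_le)
  also have "\<dots> = ennreal (real (card J) * T powr Q)"
    by (simp add: ennreal_mult ennreal_of_nat_eq_real_of_nat)
  finally have "ennreal_rpow (\<Sum>j. ennreal_rpow (a j) Q) (1 / Q) \<le>
      ennreal_rpow (ennreal (real (card J) * T powr Q)) (1 / Q)"
    using Q by (intro ennreal_rpow_mono) auto
  also have "\<dots> = ennreal (T * real (card J) powr (1 / Q))"
    using T Q by (simp add: powr_mult powr_powr mult.commute)
  finally show ?thesis
    using Q False by (simp add: lq_norm_def enn2real_inverse_ennreal)
qed

text \<open>The constants \<open>a\<close> and \<open>B\<close> are chosen before \<open>N\<close>. The upper bound comes from the scaling of the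
  quasi-norm, the lower bound from the block of frequency index \<open>0\<close>.\<close>
lemma extremal_series:
  fixes p q :: ennreal
  assumes \<Psi>: "cutoff \<Psi>" and p: "0 < p" and q: "0 < q" and A: "0 < A" and R: "0 < R"
  shows "\<exists>a>0. \<exists>B\<ge>0. \<forall>N\<ge>1. \<exists>(u :: 'a::euclidean_space \<Rightarrow> complex) us.
    schwartz u \<and> integrable lborel u \<and> dyadic_series A us \<and> distr_sums us (distr_of u) \<and>
    series_bound p q us \<le> ennreal (B * real N powr enn2real (1 / q)) \<and>
    ennreal (a * real N powr (1 / R)) \<le> besov_norm \<Psi> t (ennreal R) \<infinity> (distr_of u)"
proof -
  let ?\<Phi> = "low_pass \<Psi> :: 'a \<Rightarrow> complex"
  note \<Phi> = test_function_low_pass[OF \<Psi>, where 'a = 'a]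
  note [simp] = low_pass_eq_1[OF \<Psi>] low_pass_eq_0[OF \<Psi>]
  define G where "G = inv_fourier ?\<Phi>"
  \<comment> \<open>The values of \<open>\<Psi>\<close> between \<open>11/10\<close> and \<open>13/10\<close> may be negative, so \<open>G 0\<close> may vanish; that \<open>G\<close> is
    nonzero somewhere follows from inversion.\<close>
  have "fourier G 0 = 1"
    unfolding G_def fourier_inv_fourier[OF \<Phi>] by simp
  then have "G \<noteq> (\<lambda>_. 0)"
    by (auto simp: fourier_def)
  then obtain z where z: "G z \<noteq> 0"
    by blast
  have cont: "isCont G z"
    using inv_fourier_has_derivative[OF \<Phi>] has_derivative_continuous unfolding G_def by blast
  obtain C where C: "\<And>x. (1 + norm x) * norm (G x) \<le> C"
    using inv_fourier_decay[OF \<Phi>, of 1] by (auto simp: G_def)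
  obtain \<rho> \<delta> where \<rho>: "\<rho> > 0" and \<delta>: "\<delta> > 0" and sep: "\<And>N::nat. \<exists>y.
      disjoint_family_on (\<lambda>i. ball (y i + z) \<rho>) {1..N} \<and>
      (\<forall>i\<in>{1..N}. \<forall>x\<in>ball (y i + z) \<rho>. \<delta> \<le> norm (\<Sum>j\<in>{1..N}. G (x - y j)))"
    using separated_translates[OF cont z C] by blast
  define a where "a = (\<delta> powr R * (unit_ball_vol (real DIM('a)) * \<rho> ^ DIM('a))) powr (1 / R)"
  have "unit_ball_vol (real DIM('a)) \<noteq> 0"
    using unit_ball_vol_pos[of "real DIM('a)"] by linarith
  then have a: "a > 0" using \<rho> \<delta> by (simp add: a_def)
  obtain K where K: "K \<ge> 0" "\<And>s y. s > 0 \<Longrightarrow> Lp_norm p (\<lambda>x. of_real (s ^ DIM('a)) * G (s *\<^sub>R (x - y)))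
      \<le> ennreal (s powr (real DIM('a) - real DIM('a) * enn2real (1 / p)) * K)"
    using Lp_norm_dilate_le[OF \<Phi> p] unfolding G_def by blast
  obtain m :: nat where m: "13/10 < A * 2 ^ m"
    using real_arch_pow[of 2 "13/10 / A"] A by (auto simp: field_simps)
  let ?w = "real DIM('a) * enn2real (1 / p) - real DIM('a)"
  define B where "B = 2 powr (real m * ?w) * K"
  have B: "B \<ge> 0" using K by (simp add: B_def)
  have "\<exists>(u :: 'a \<Rightarrow> complex) us.
    schwartz u \<and> integrable lborel u \<and> dyadic_series A us \<and> distr_sums us (distr_of u) \<and>
    series_bound p q us \<le> ennreal (B * real N powr enn2real (1 / q)) \<and>
    ennreal (a * real N powr (1 / R)) \<le> besov_norm \<Psi> t (ennreal R) \<infinity> (distr_of u)" if N: "N \<ge> 1" for N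
  proof -
    obtain y where disj: "disjoint_family_on (\<lambda>i. ball (y i + z) \<rho>) {1..N}"
      and ge: "\<And>i x. i \<in> {1..N} \<Longrightarrow> x \<in> ball (y i + z) \<rho> \<Longrightarrow> \<delta> \<le> norm (\<Sum>j\<in>{1..N}. G (x - y j))"
      using sep by blast
    \<comment> \<open>The Fourier transform of \<open>V\<^sub>i\<close>; the term of index \<open>j\<close> is \<open>V\<^sub>i\<close> with \<open>i = j - m\<close>.\<close>
    define \<psi> where "\<psi> i \<xi> = iexp ((- y i) \<bullet> \<xi>) * ?\<Phi> ((1 / 2 ^ i) *\<^sub>R \<xi>)" for i \<xi>
    define J where "J = {1 + m..N + m}"
    define \<eta> where "\<eta> j = (if j \<in> J then \<psi> (j - m) else (\<lambda>_. 0))" for j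
    define us where "us j = distr_of (inv_fourier (\<eta> j))" for j
    define u where "u = inv_fourier (\<lambda>\<xi>. \<Sum>j\<in>J. \<eta> j \<xi>)"
    have \<psi>0: "\<psi> i \<xi> = 0" if "13/10 * 2 ^ i < norm \<xi>" for i \<xi>
      using that by (simp add: \<psi>_def field_simps)
    have "test_function (\<psi> i)" for i
      unfolding test_function_iff
    proof
      show "smooth (\<psi> i)"
        unfolding \<psi>_def by (intro smooth_mult smooth_cis smooth_scale test_function_smooth \<Phi>)
      show "\<exists>R. \<forall>x. R < norm x \<longrightarrow> \<psi> i x = 0"
        using \<psi>0 by blast
    qed
    then have \<eta>: "test_function (\<eta> j)" for j
      by (simp add: \<eta>_def test_function_iff smooth_const)
    have \<eta>0: "\<eta> j \<xi> = 0" if "A * 2 ^ j < norm \<xi>" for j \<xi>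
    proof (cases "j \<in> J")
      case True
      then have "(2::real) ^ j = 2 ^ m * 2 ^ (j - m)"
        by (simp add: J_def flip: power_add)
      then have "13/10 * 2 ^ (j - m) \<le> A * 2 ^ j"
        using m by (simp add: mult.assoc[symmetric])
      then show ?thesis using that True by (simp add: \<eta>_def \<psi>0)
    qed (simp add: \<eta>_def)
    have S: "test_function (\<lambda>\<xi>. \<Sum>j\<in>J. \<eta> j \<xi>)"
      by (intro test_function_sum \<eta>)
    have int: "integrable lborel (inv_fourier (\<eta> j))" for j
      by (rule inv_fourier_integrable[OF \<eta>])
    have "dyadic_series A us"
      unfolding dyadic_series_def us_def
      using tempered_distr_of[OF int] distr_supp_fourier_inv_fourier[OF \<eta> \<eta>0] by blast
    moreover have "distr_sums us (distr_of u)"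
      unfolding distr_sums_def
    proof (intro allI impI)
      fix \<phi> :: "'a \<Rightarrow> complex" assume \<phi>: "schwartz \<phi>"
      have "us j \<phi> = 0" if "j \<notin> J" for j
        using that by (simp add: us_def \<eta>_def distr_of_def inv_fourier_def)
      then have "(\<lambda>j. us j \<phi>) sums (\<Sum>j\<in>J. us j \<phi>)"
        by (intro sums_finite) (auto simp: J_def)
      also have "(\<Sum>j\<in>J. us j \<phi>) = distr_of u \<phi>"
        unfolding us_def u_def distr_of_def
        using integrable_mult_schwartz[OF int \<phi>]
        by (subst Bochner_Integration.integral_sum[symmetric])
          (auto simp: inv_fourier_sum test_function_integrable[OF \<eta>] sum_distrib_right)
      finally show "(\<lambda>j. us j \<phi>) sums distr_of u \<phi>" .
    qed
    moreover have "series_bound p q us \<le> ennreal (B * real N powr enn2real (1 / q))"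
    proof -
      let ?a = "\<lambda>j. ennreal (2 powr (real j * ?w)) * distr_Lp_norm p (us j)"
      have norm_us: "distr_Lp_norm p (us j) = Lp_norm p (inv_fourier (\<eta> j))" for j
        unfolding us_def by (rule distr_Lp_norm_eq[OF \<Psi> represented_by_distr_of[OF int]])
      have "lq_norm q ?a \<le> ennreal (B * real (card J) powr enn2real (1 / q))"
      proof (rule lq_norm_le_card[OF q _ _ B])
        show "finite J" "J \<noteq> {}" using N by (auto simp: J_def)
        fix j assume j: "j \<in> J"
        have "inv_fourier (\<eta> j) = (\<lambda>x. of_real ((2 ^ (j - m)) ^ DIM('a)) * G (2 ^ (j - m) *\<^sub>R (x - y (j - m))))"
          using j inv_fourier_modulate_scale[of "2 ^ (j - m)" ?\<Phi>] smooth_measurable[OF test_function_smooth[OF \<Phi>]]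
          by (simp add: \<eta>_def \<psi>_def[abs_def] G_def fun_eq_iff)
        then have "?a j \<le> ennreal (2 powr (real j * ?w)) * ennreal ((2 ^ (j - m)) powr (- ?w) * K)"
          unfolding norm_us using K(2)[of "2 ^ (j - m)" "y (j - m)"] by (simp add: mult_left_mono)
        also have "\<dots> = ennreal (2 powr (real j * ?w) * ((2 ^ (j - m)) powr (- ?w) * K))"
          using K by (simp add: ennreal_mult)
        also have "2 powr (real j * ?w) * ((2 ^ (j - m)) powr (- ?w) * K) = B"
        proof -
          have "(2 ^ (j - m)) powr (- ?w) = 2 powr (real (j - m) * (- ?w))"
            by (simp add: powr_powr flip: powr_realpow)
          moreover have "real j * ?w + real (j - m) * (- ?w) = real m * ?w"
            using j by (simp add: J_def of_nat_diff algebra_simps)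
          ultimately have "2 powr (real j * ?w) * (2 ^ (j - m)) powr (- ?w) = 2 powr (real m * ?w)"
            by (simp flip: powr_add)
          then show ?thesis by (simp add: B_def mult.assoc[symmetric])
        qed
        finally show "?a j \<le> ennreal B" .
      next
        fix j assume "j \<notin> J"
        then have "inv_fourier (\<eta> j) = (\<lambda>_. 0)"
          by (simp add: \<eta>_def inv_fourier_def fun_eq_iff)
        moreover have "Lp_norm p (\<lambda>_::'a. 0) = 0"
          using ennreal_rpow_ennreal[of 0] by (simp add: Lp_norm_def esssup_const)
        ultimately show "?a j = 0" unfolding norm_us by simp
      qed
      then show ?thesis
        by (simp add: series_bound_def J_def)
    qed
    moreover have "ennreal (a * real N powr (1 / R)) \<le> besov_norm \<Psi> t (ennreal R) \<infinity> (distr_of u)"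
    proof -
      let ?g = "\<lambda>x. \<Sum>i\<in>{1..N}. G (x - y i)"
      \<comment> \<open>Multiplication by \<open>\<Phi>\<^sub>0\<close> removes the dilations.\<close>
      have block: "inv_fourier (\<lambda>\<xi>. ?\<Phi> \<xi> * (\<Sum>j\<in>J. \<eta> j \<xi>)) = ?g"
      proof
        fix x
        have i: "integrable lborel (\<lambda>\<xi>. iexp ((- y i) \<bullet> \<xi>) * ?\<Phi> \<xi>)" for i
          by (intro integrable_iexp_mult test_function_integrable \<Phi>)
        have "?\<Phi> \<xi> * (\<Sum>j\<in>J. \<eta> j \<xi>) = (\<Sum>i\<in>{1..N}. iexp ((- y i) \<bullet> \<xi>) * ?\<Phi> \<xi>)" for \<xi>
        proof -
          have "(\<Sum>j\<in>J. \<eta> j \<xi>) = (\<Sum>j\<in>J. \<psi> (j - m) \<xi>)"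
            by (intro sum.cong) (auto simp: \<eta>_def)
          also have "\<dots> = (\<Sum>i\<in>{1..N}. \<psi> i \<xi>)"
            unfolding J_def by (subst sum.shift_bounds_cl_nat_ivl) simp
          finally have "?\<Phi> \<xi> * (\<Sum>j\<in>J. \<eta> j \<xi>) = (\<Sum>i\<in>{1..N}. \<psi> i \<xi> * ?\<Phi> \<xi>)"
            by (simp add: sum_distrib_left mult.commute)
          also have "\<dots> = (\<Sum>i\<in>{1..N}. iexp ((- y i) \<bullet> \<xi>) * ?\<Phi> \<xi>)"
          proof (rule sum.cong[OF refl])
            fix i assume i: "i \<in> {1..N}"
            show "\<psi> i \<xi> * ?\<Phi> \<xi> = iexp ((- y i) \<bullet> \<xi>) * ?\<Phi> \<xi>"
            proof (cases "13/10 < norm \<xi>")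
              case False
              \<comment> \<open>Here \<open>i \<ge> 1\<close> is used: it gives \<open>\<bar>\<xi>\<bar> / 2\<^sup>i \<le> 13/20 < 11/10\<close>.\<close>
              have "(2::real) ^ 1 \<le> 2 ^ i" using i by (intro power_increasing) auto
              then have "norm ((1 / 2 ^ i) *\<^sub>R \<xi>) < 11/10"
                using False by (simp add: field_simps)
              then show ?thesis by (simp add: \<psi>_def del: norm_scaleR)
            qed simp
          qed
          finally show ?thesis .
        qed
        then have "inv_fourier (\<lambda>\<xi>. ?\<Phi> \<xi> * (\<Sum>j\<in>J. \<eta> j \<xi>)) x =
            (\<Sum>i\<in>{1..N}. inv_fourier (\<lambda>\<xi>. iexp ((- y i) \<bullet> \<xi>) * ?\<Phi> \<xi>) x)"
          by (simp only: inv_fourier_sum[OF i])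
        also have "\<dots> = ?g x"
          using inv_fourier_modulate_scale[of 1 ?\<Phi>] smooth_measurable[OF test_function_smooth[OF \<Phi>]]
          by (simp add: G_def)
        finally show "inv_fourier (\<lambda>\<xi>. ?\<Phi> \<xi> * (\<Sum>j\<in>J. \<eta> j \<xi>)) x = ?g x" .
      qed
      have "LP_block \<Psi> 0 (distr_of u) =
          distr_inv_fourier (distr_mult ?\<Phi> (distr_fourier (distr_of u)))"
        by (simp add: LP_block_def low_pass_def[abs_def])
      then have rep: "represented_by (LP_block \<Psi> 0 (distr_of u)) ?g"
        using represented_by_multiplier[OF S \<Phi>] unfolding block u_def by simp
      have "ennreal (real (card {1..N}) powr (1 / R) * a) \<le> Lp_norm (ennreal R) ?g"
        unfolding a_def
        by (rule Lp_norm_ge_separated[OF R _ _ _ _ disj ge])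
          (use rep \<rho> \<delta> in \<open>auto simp: represented_by_def\<close>)
      also have "\<dots> = ennreal (2 powr (t * real 0)) * distr_Lp_norm (ennreal R) (LP_block \<Psi> 0 (distr_of u))"
        by (simp add: distr_Lp_norm_eq[OF \<Psi> rep])
      also have "\<dots> \<le> besov_norm \<Psi> t (ennreal R) \<infinity> (distr_of u)"
        unfolding besov_norm_def lq_norm_def if_P[OF refl] by (rule SUP_upper) simp
      finally show ?thesis by (simp add: mult.commute)
    qed
    moreover have "schwartz u" "integrable lborel u"
      unfolding u_def by (rule schwartz_inv_fourier[OF S], rule inv_fourier_integrable[OF S])
    ultimately show ?thesis by blast
  qed
  with a B show ?thesis by blast
qed

text \<open>If \<open>r < q\<close> then \<open>N\<^sup>1\<^sup>/\<^sup>r\<close> outgrows every multiple of \<open>N\<^sup>1\<^sup>/\<^sup>q\<close>, so a large \<open>N\<close> defeats the constant \<open>c\<close>. The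
  distribution and the series meet the requirements of both assertions of the theorem.\<close>
lemma unbounded_ratio:
  fixes p q r c :: ennreal
  assumes \<Psi>: "cutoff \<Psi>" and p: "0 < p" and A: "0 < A" and r: "0 < r" "r < q" and c: "c < \<infinity>"
  obtains u :: "'a::euclidean_space \<Rightarrow> complex" and us where
    "schwartz u" "tempered (distr_of u)" "dyadic_series A us" "distr_sums us (distr_of u)"
    "series_bound p q us < \<infinity>"
    "\<not> besov_norm \<Psi> t r \<infinity> (distr_of u) \<le> c * series_bound p q us"
proof -
  obtain R where R: "r = ennreal R" "0 < R"
    using r by (cases r) auto
  have q: "0 < q" using r by (rule less_trans)
  obtain a B where a: "a > 0" and B: "B \<ge> 0" and ex: "\<And>N::nat. N \<ge> 1 \<Longrightarrow>
    \<exists>(u :: 'a \<Rightarrow> complex) us.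
    schwartz u \<and> integrable lborel u \<and> dyadic_series A us \<and> distr_sums us (distr_of u) \<and>
    series_bound p q us \<le> ennreal (B * real N powr enn2real (1 / q)) \<and>
    ennreal (a * real N powr (1 / R)) \<le> besov_norm \<Psi> t (ennreal R) \<infinity> (distr_of u)"
    using extremal_series[OF \<Psi> p q A R(2), of t] by metis
  obtain c' where c': "c = ennreal c'" "0 \<le> c'"
    using c by (cases c) auto
  define d where "d = 1 / R - enn2real (1 / q)"
  have d: "d > 0"
  proof (cases "q = \<infinity>")
    case False
    then obtain Q where "q = ennreal Q" "0 < Q" using q by (cases q) auto
    with r R show ?thesis
      by (simp add: d_def enn2real_inverse_ennreal ennreal_less_iff frac_less2)
  qed (use R in \<open>simp add: d_def\<close>)
  obtain N :: nat where N: "(c' * B / a + 1) powr (1 / d) \<le> real N"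
    using real_arch_simple by blast
  have base: "1 \<le> c' * B / a + 1" using c' B a by simp
  then have "1 \<le> (c' * B / a + 1) powr (1 / d)"
    using d by (intro ge_one_powr_ge_zero) auto
  with N have N1: "N \<ge> 1" by linarith
  have "c' * B / a + 1 = ((c' * B / a + 1) powr (1 / d)) powr d"
    using base d by (simp add: powr_powr)
  also have "\<dots> \<le> real N powr d"
    using N d by (intro powr_mono2) auto
  finally have "c' * B < a * real N powr d"
    using a by (simp add: field_simps)
  then have "(c' * B) * real N powr enn2real (1 / q) < (a * real N powr d) * real N powr enn2real (1 / q)"
    using N1 by (intro mult_strict_right_mono) auto
  also have "\<dots> = a * real N powr (1 / R)"
    using N1 by (simp add: d_def mult.assoc flip: powr_add)
  finally have less: "c' * (B * real N powr enn2real (1 / q)) < a * real N powr (1 / R)"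
    by (simp add: mult.assoc)
  obtain u :: "'a \<Rightarrow> complex" and us where u: "schwartz u" "integrable lborel u" "dyadic_series A us"
    "distr_sums us (distr_of u)"
    and up: "series_bound p q us \<le> ennreal (B * real N powr enn2real (1 / q))"
    and low: "ennreal (a * real N powr (1 / R)) \<le> besov_norm \<Psi> t (ennreal R) \<infinity> (distr_of u)"
    using ex[OF N1] by blast
  have "c * series_bound p q us \<le> ennreal (c' * (B * real N powr enn2real (1 / q)))"
    using up c' B by (simp add: ennreal_mult mult_left_mono)
  also have "\<dots> < ennreal (a * real N powr (1 / R))"
    using less a N1 by (intro ennreal_lessI) auto
  also note low
  finally have "\<not> besov_norm \<Psi> t r \<infinity> (distr_of u) \<le> c * series_bound p q us"
    by (simp add: R not_le)
  moreover have "series_bound p q us < \<infinity>"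
    using up by (rule le_less_trans) simp
  ultimately show ?thesis
    using u tempered_distr_of by (intro that) auto
qed

theorem proposition3p2:
  fixes \<Psi> :: "real \<Rightarrow> real" and p q :: ennreal and A :: real
  assumes "cutoff \<Psi>" and "0 < p" and "0 < q" and "0 < A"
  shows
    "(\<forall>(t::real) (r::ennreal) (c::ennreal). 0 < r \<longrightarrow> 0 < c \<longrightarrow> c < \<infinity> \<longrightarrow>
        (\<forall>(u :: real ^ 'n \<Rightarrow> complex) us.
           schwartz u \<longrightarrow> dyadic_series A us \<longrightarrow> distr_sums us (distr_of u) \<longrightarrow>
           besov_norm \<Psi> t r \<infinity> (distr_of u) \<le> c * series_bound p q us) \<longrightarrow>
        q \<le> r)
     \<and>
     (p < q \<longrightarrow> q \<le> 1 \<longrightarrow>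
        \<not> (\<exists>(r::ennreal) (t::real) (c::ennreal). 0 < r \<and> r < q \<and> c < \<infinity> \<and>
             (\<forall>(us :: nat \<Rightarrow> (real ^ 'n) distr) u.
                dyadic_series A us \<longrightarrow> series_bound p q us < \<infinity> \<longrightarrow>
                tempered u \<longrightarrow> distr_sums us u \<longrightarrow>
                u \<in> besov_space \<Psi> t r \<infinity> \<and>
                besov_norm \<Psi> t r \<infinity> u \<le> c * series_bound p q us)))"
proof (rule conjI, goal_cases)
  case 1
  show ?case
  proof (intro allI impI)
    fix t :: real and r c :: ennreal
    assume r: "0 < r" and c: "c < \<infinity>"
      and bound: "\<forall>(u :: real ^ 'n \<Rightarrow> complex) us.
           schwartz u \<longrightarrow> dyadic_series A us \<longrightarrow> distr_sums us (distr_of u) \<longrightarrow>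
           besov_norm \<Psi> t r \<infinity> (distr_of u) \<le> c * series_bound p q us"
    show "q \<le> r"
    proof (rule ccontr)
      assume "\<not> q \<le> r"
      then have "r < q" by simp
      then show False
        using unbounded_ratio[OF assms(1,2,4) r _ c, where 'a = "real ^ 'n" and t = t] bound by metis
    qed
  qed
next
  case 2
  show ?case
  proof (intro impI notI, elim exE conjE)
    fix r :: ennreal and t :: real and c :: ennreal
    assume r: "0 < r" "r < q" and c: "c < \<infinity>"
      and bound: "\<forall>(us :: nat \<Rightarrow> (real ^ 'n) distr) u.
                dyadic_series A us \<longrightarrow> series_bound p q us < \<infinity> \<longrightarrow>
                tempered u \<longrightarrow> distr_sums us u \<longrightarrow>
                u \<in> besov_space \<Psi> t r \<infinity> \<and>
                besov_norm \<Psi> t r \<infinity> u \<le> c * series_bound p q us"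
    show False
      using unbounded_ratio[OF assms(1,2,4) r c, where 'a = "real ^ 'n" and t = t] bound by metis
  qed
qed

end
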